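(* Assume that for every $n\in\mathbb N$ there are constants $0<m_{2n}\le M_{2n}$ and $M_{2n+1}>0$ such that for all $v\in H$: i) $m_{2n}\|v\|_{W_1}^2\le\|B_1^*(t)v\|_{U_1}^2\le M_{2n}\|v\|_{W_1}^2$ for $t\in I_{2n}$; ii) $\|B_2^*(t)v\|_{U_2}^2\le M_{2n+1}\|v\|_{W_2}^2$ for $t\in I_{2n+1}$. Assume that there is a time $\overline T>0$ such that for every $T>\overline T$ there is a constant $c=c(T)>0$, independent of the initial data, such that $$\frac12\left(\|w_0\|_V^2+\|w_1\|_H^2\right)\le c\int_0^T\|w_t(s)\|_{W_1}^2\,ds$$ for every weak solution $w$ of $w_{tt}+Aw=0$, $t>0$, $w(0)=w_0$, $w_t(0)=w_1$ with $(w_0,w_1)\in V\times H$. Assume that $T_{2n}=T^*$ for all $n\in\mathbb N$, with $T^*>\overline T$ and $T^*\ge\tau$, and that $T_{2n+1}=\tilde T$ for all $n\in\mathbb N$, with $\tilde T\le\tau$. Assume moreover that $$\sup_{n\in\mathbb N}\left[e^{C_2M_{2n+1}\tilde T}(\hat c_n+1)-1\right]=\hat d<1,\qquad \hat c_n=\frac{2c(1+4C_1^2T_{2n}^2M_{2n}^2)}{m_{2n}+2c(1+4C_1^2T_{2n}^2M_{2n}^2)},$$ where $c=c(T^* )$. Then there exist two positive constants $\hat\gamma,\hat\mu$ such that $$E_S(u,t)\le\hat\gamma e^{-\hat\mu t}E_S(u,0),\qquad t>0,$$ for any solution $u$ of the delayed problem.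
   Context: $\mathbb N=\{0,1,2,\dots\}$. $H$ is a real Hilbert space; $A:\mathcal D(A)\to H$ is a positive self-adjoint operator with compact inverse; $V=\mathcal D(A^{1/2})$ with $\|v\|_V=\|A^{1/2}v\|_H$; $V'$ is the dual of $V$ with pivot space $H$. $U_1,U_2$ are real Hilbert spaces, identified with their duals; $\tau>0$ is fixed. $0=t_0<t_1<t_2<\cdots$ is a sequence, $I_n=[t_n,t_{n+1})$, $T_n=t_{n+1}-t_n$, and $T_{2n}\ge\tau$ for all $n$. $B_1(t)\in\mathcal L(U_1,H)$, $B_2(t)\in\mathcal L(U_2,H)$ satisfy, for all $n$: $B_2(t)=0$ for $t\in I_{2n}$, $B_1(t)=0$ for $t\in I_{2n+1}$, $B_1\in C^1([t_{2n},t_{2n+1}];\mathcal L(U_1,H))$ and $B_2\in C([t_{2n+1},t_{2n+2}];\mathcal L(U_2,H))$ (continuity up to the right endpoint is understood as existence of an extension from the half-open interval). $W_1,W_2$ are Hilbert spaces in which $H$ is continuously embedded, with $C_i>0$ such that $\|v\|_{W_i}^2\le C_i\|v\|_H^2$ for all $v\in H$, $i=1,2$. Delayed problem: $$u_{tt}(t)+Au(t)+B_1(t)B_1^*(t)u_t(t)+B_2(t)B_2^*(t)u_t(t-\tau)=0,\ t>0,\qquad u(0)=u_0\in V,\ u_t(0)=u_1\in H.$$ The delay term is $0$ whenever $B_2(t)=0$, in particular on $[0,\tau)$, so no history data are needed. A solution is a mild (equivalently weak, with the equation holding in $V'$) solution $u\in C([0,\infty);V)\cap C^1([0,\infty);H)$.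 Standard energy: $E_S(t)=E_S(u,t):=\frac12\left(\|u(t)\|_V^2+\|u_t(t)\|_H^2\right)$. *)

theory Defs
  imports "HOL-Analysis.Analysis"
begin

text \<open>
  A real Hilbert space is a type of sort \<open>{real_inner, complete_space}\<close>.
  An unbounded operator is a pair \<open>D A\<close> of a domain and a function whose values outside
  \<open>D\<close> are irrelevant.
\<close>

definition densely_defined_linear :: "'h::real_inner set \<Rightarrow> ('h \<Rightarrow> 'h) \<Rightarrow> bool" where
  "densely_defined_linear D A \<longleftrightarrow>
     subspace D \<and> closure D = UNIV \<and>
     (\<forall>x\<in>D. \<forall>y\<in>D. A (x + y) = A x + A y) \<and>
     (\<forall>r. \<forall>x\<in>D. A (r *\<^sub>R x) = r *\<^sub>R A x)"

text \<open>
  The graph of the adjoint is \<open>{(y, z). \<forall>x\<in>D. A x \<bullet> y = x \<bullet> z}\<close>; self-adjointness says that it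
  coincides with the graph of \<open>A\<close>, equality of the domains included.
\<close>

definition self_adjoint_op :: "'h::real_inner set \<Rightarrow> ('h \<Rightarrow> 'h) \<Rightarrow> bool" where
  "self_adjoint_op D A \<longleftrightarrow>
     densely_defined_linear D A \<and>
     (\<forall>y z. (\<forall>x\<in>D. A x \<bullet> y = x \<bullet> z) \<longleftrightarrow> (y \<in> D \<and> z = A y))"

definition positive_op :: "'h::real_inner set \<Rightarrow> ('h \<Rightarrow> 'h) \<Rightarrow> bool" where
  "positive_op D A \<longleftrightarrow> (\<forall>x\<in>D. x \<noteq> 0 \<longrightarrow> 0 < A x \<bullet> x)"

definition compact_inverse :: "'h::real_inner set \<Rightarrow> ('h \<Rightarrow> 'h) \<Rightarrow> bool" where
  "compact_inverse D A \<longleftrightarrow>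
     bij_betw A D UNIV \<and>
     (\<forall>X. bounded X \<longrightarrow> compact (closure (inv_into D A ` X)))"

text \<open>
  \<open>S\<close> with domain \<open>V\<close> is the square root of \<open>A\<close>, i.e. the (unique) positive self-adjoint
  operator with \<open>S \<circ> S = A\<close> as unbounded operators.
\<close>

definition is_sqrt_op ::
    "'h::real_inner set \<Rightarrow> ('h \<Rightarrow> 'h) \<Rightarrow> 'h set \<Rightarrow> ('h \<Rightarrow> 'h) \<Rightarrow> bool" where
  "is_sqrt_op D A V S \<longleftrightarrow>
     self_adjoint_op V S \<and> positive_op V S \<and>
     D = {x \<in> V. S x \<in> V} \<and> (\<forall>x\<in>D. A x = S (S x))"

definition normV :: "('h::real_inner \<Rightarrow> 'h) \<Rightarrow> 'h \<Rightarrow> real" where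
  "normV S v = norm (S v)"

definition std_energy ::
    "('h::real_inner \<Rightarrow> 'h) \<Rightarrow> (real \<Rightarrow> 'h) \<Rightarrow> (real \<Rightarrow> 'h) \<Rightarrow> real \<Rightarrow> real" where
  "std_energy S u ut t = 1/2 * ((normV S (u t))\<^sup>2 + (norm (ut t))\<^sup>2)"

definition C1_up_to_right_end ::
    "(real \<Rightarrow> 'b::real_normed_vector) \<Rightarrow> real \<Rightarrow> real \<Rightarrow> bool" where
  "C1_up_to_right_end B a b \<longleftrightarrow>
     (\<exists>F F'. (\<forall>t\<in>{a..<b}. F t = B t) \<and>
             (\<forall>t\<in>{a..b}. (F has_vector_derivative F' t) (at t within {a..b})) \<and>
             continuous_on {a..b} F')"

definition C0_up_to_right_end ::
    "(real \<Rightarrow> 'b::real_normed_vector) \<Rightarrow> real \<Rightarrow> real \<Rightarrow> bool" where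
  "C0_up_to_right_end B a b \<longleftrightarrow>
     (\<exists>F. (\<forall>t\<in>{a..<b}. F t = B t) \<and> continuous_on {a..b} F)"

text \<open>
  \<open>weak_wave_solution V S N f u0 u1 u ut\<close>: \<open>u \<in> C([0,\<infinity>);V) \<inter> C\<^sup>1([0,\<infinity>);H)\<close> with time derivative
  \<open>ut\<close>, initial data \<open>(u0, u1)\<close>, and \<open>u\<^sub>t\<^sub>t + A u = f\<close> in the dual of \<open>V\<close> (pivot space \<open>H\<close>), tested
  with \<open>v \<in> V\<close>; the duality pairing of \<open>A u\<close> with \<open>v\<close> is \<open>S u \<bullet> S v\<close>. As \<open>S\<close> is linear on \<open>V\<close> and
  \<open>normV S v = norm (S v)\<close>, continuity of \<open>u\<close> into \<open>V\<close> is continuity of \<open>S \<circ> u\<close> into \<open>H\<close>.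
  The equation is not imposed at times in \<open>N\<close>, where \<open>f\<close> may jump.
\<close>

definition weak_wave_solution ::
    "'h::real_inner set \<Rightarrow> ('h \<Rightarrow> 'h) \<Rightarrow> real set \<Rightarrow> (real \<Rightarrow> 'h) \<Rightarrow> 'h \<Rightarrow> 'h
      \<Rightarrow> (real \<Rightarrow> 'h) \<Rightarrow> (real \<Rightarrow> 'h) \<Rightarrow> bool" where
  "weak_wave_solution V S N f u0 u1 u ut \<longleftrightarrow>
     (\<forall>t\<ge>0. u t \<in> V) \<and> continuous_on {0..} (\<lambda>t. S (u t)) \<and>
     (\<forall>t\<ge>0. (u has_vector_derivative ut t) (at t within {0..})) \<and> continuous_on {0..} ut \<and>
     u 0 = u0 \<and> ut 0 = u1 \<and>
     (\<forall>t>0. t \<notin> N \<longrightarrow>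
        (\<forall>v\<in>V. ((\<lambda>s. ut s \<bullet> v) has_real_derivative (f t \<bullet> v - S (u t) \<bullet> S v)) (at t)))"

definition free_wave_solution ::
    "'h::real_inner set \<Rightarrow> ('h \<Rightarrow> 'h) \<Rightarrow> 'h \<Rightarrow> 'h \<Rightarrow> (real \<Rightarrow> 'h) \<Rightarrow> (real \<Rightarrow> 'h) \<Rightarrow> bool" where
  "free_wave_solution V S w0 w1 w wt \<longleftrightarrow> weak_wave_solution V S {} (\<lambda>t. 0) w0 w1 w wt"

text \<open>
  \<open>B1\<close> and \<open>B2\<close> are discontinuous at the switching times only. For \<open>t < \<tau>\<close> the meaningless value
  \<open>ut (t - \<tau>)\<close> is multiplied by \<open>B2 t B2\<^sup>* t = 0\<close>.
\<close>

definition delayed_wave_solution ::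
    "'h::real_inner set \<Rightarrow> ('h \<Rightarrow> 'h) \<Rightarrow> (nat \<Rightarrow> real) \<Rightarrow> real
      \<Rightarrow> (real \<Rightarrow> ('u1::real_inner \<Rightarrow>\<^sub>L 'h)) \<Rightarrow> (real \<Rightarrow> ('u2::real_inner \<Rightarrow>\<^sub>L 'h))
      \<Rightarrow> 'h \<Rightarrow> 'h \<Rightarrow> (real \<Rightarrow> 'h) \<Rightarrow> (real \<Rightarrow> 'h) \<Rightarrow> bool" where
  "delayed_wave_solution V S tn \<tau> B1 B2 u0 u1 u ut \<longleftrightarrow>
     weak_wave_solution V S (range tn)
       (\<lambda>t. - (blinfun_apply (B1 t) (adjoint (blinfun_apply (B1 t)) (ut t))
             + blinfun_apply (B2 t) (adjoint (blinfun_apply (B2 t)) (ut (t - \<tau>)))))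
       u0 u1 u ut"

definition c_hat :: "real \<Rightarrow> real \<Rightarrow> real \<Rightarrow> real \<Rightarrow> real \<Rightarrow> real" where
  "c_hat c C1 T m M =
     2 * c * (1 + 4 * C1\<^sup>2 * T\<^sup>2 * M\<^sup>2) / (m + 2 * c * (1 + 4 * C1\<^sup>2 * T\<^sup>2 * M\<^sup>2))"

end

theory Submission
  imports Defs
begin

text \<open>
  On an even interval the energy drops by \<open>Y\<close>, the integral of \<open>\<parallel>B\<^sub>1\<^sup>* u\<^sub>t\<parallel>\<^sup>2\<close>. Comparing \<open>u\<close> with the
  free wave with the same data at the beginning of the interval, the observability inequality
  bounds the initial energy by a multiple of \<open>Y\<close>, so that the energy contracts by the factor
  \<open>c_hat\<close>. On the following odd interval, which is not longer than \<open>\<tau>\<close>, the delayed term only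
  sees the preceding even interval, and Gronwall's lemma controls the growth. The product over a
  full cycle is at most \<open>dhat < 1\<close>.

  Neither the existence of free waves nor the regularity needed for the energy identity is
  available a priori; both are derived from the eigenvectors of the compact operator \<open>A\<^sup>-\<^sup>1\<close>. Free
  waves with data in their span are explicit, and such data are dense. The energy identity holds
  for the images of a weak solution under operators \<open>J\<^sub>k\<close> with range in the domain of \<open>A\<close>,
  where \<open>J\<^sub>k\<close> converges strongly to the identity.
\<close>

text \<open>The weak equation may be tested only with vectors of \<open>V\<close>, whereas
  \<open>ut\<close> takes values in \<open>H\<close>; this is why the energy cannot be
  differentiated directly. The smoothing operators are polynomials in
  \<open>A\<^sup>-\<^sup>1\<close> rather than spectral projections, so the argument works with the
  span of the eigenvectors and never picks an orthonormal basis. The constants arise as follows. Put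
  \<open>K = 2 c (1 + 4 C1^2 T^2 M^2)\<close>, where the summand 1 comes from the damped wave and
  the other summand from its difference to the free wave. With \<open>E0\<close> and
  \<open>ET\<close> the energies at the ends of an even interval, the comparison gives
  \<open>m E0 <= K (E0 - ET)\<close>; solving for \<open>ET\<close> yields the ratio
  \<open>K / (m + K)\<close>, which is \<open>c_hat\<close>. On an odd interval the delayed kinetic
  energy is at most the energy \<open>Ea\<close> at the start of the cycle, and Gronwall's lemma is
  applied to the energy plus \<open>Ea\<close>: this produces the \<open>+ 1\<close> and the
  \<open>- 1\<close> under the supremum.\<close>

lemma parallelogram: "(norm (x + y))\<^sup>2 + (norm (x - y))\<^sup>2 = 2 * (norm x)\<^sup>2 + 2 * (norm (y::'a::real_inner))\<^sup>2"
  by (simp add: power2_norm_eq_inner algebra_simps inner_commute)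

section \<open>Nearest points, orthogonal complements and the Riesz representation\<close>

lemma nearest_point_exists:
  fixes K :: "'a::{real_inner, complete_space} set"
  assumes K: "subspace K" "closed K"
  shows "\<exists>y\<in>K. \<forall>k\<in>K. norm (x - y) \<le> norm (x - k)"
proof -
  define d where "d = infdist x K"
  have ne: "K \<noteq> {}" using K(1) subspace_0 by blast
  have d0: "d \<ge> 0" unfolding d_def by (rule infdist_nonneg)
  have low: "d \<le> norm (x - k)" if "k \<in> K" for k
    unfolding d_def using infdist_le[OF that, of x] by (simp add: dist_norm)
  have "\<exists>y\<in>K. norm (x - y) < d + 1 / real (Suc n)" for n
  proof -
    have "infdist x K < d + 1 / real (Suc n)" unfolding d_def by simp
    then show ?thesis using cInf_lessD[of "dist x ` K"] ne
      by (auto simp: infdist_def dist_norm)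
  qed
  then obtain Y where Y: "\<And>n. Y n \<in> K" "\<And>n. norm (x - Y n) < d + 1 / real (Suc n)" by metis
  \<comment> \<open>Parallelogram law for \<open>x - Y m\<close> and \<open>x - Y n\<close>: their
    sum is twice the difference between \<open>x\<close> and the midpoint, which lies in
    \<open>K\<close>, so it has norm at least \<open>2 * d\<close>.\<close>
  have est: "(norm (Y m - Y n))\<^sup>2 \<le> 2 * (d + 1 / real (Suc m))\<^sup>2 + 2 * (d + 1 / real (Suc n))\<^sup>2 - 4 * d\<^sup>2" for m n
  proof -
    have "(1/2) *\<^sub>R (Y m + Y n) \<in> K" using Y(1) K(1) by (simp add: subspace_add subspace_scale)
    then have "d \<le> norm (x - (1/2) *\<^sub>R (Y m + Y n))" by (rule low)
    also have "\<dots> = norm ((x - Y m) + (x - Y n)) / 2"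
    proof -
      have "(x - Y m) + (x - Y n) = 2 *\<^sub>R (x - (1/2) *\<^sub>R (Y m + Y n))"
        by (simp add: algebra_simps scaleR_2)
      then show ?thesis by simp
    qed
    finally have "(2 * d)\<^sup>2 \<le> (norm ((x - Y m) + (x - Y n)))\<^sup>2"
      using d0 by (intro power_mono) auto
    moreover have "(norm (Y m - Y n))\<^sup>2 = (norm ((x - Y m) - (x - Y n)))\<^sup>2"
      by (simp add: norm_minus_commute)
    moreover have "(norm (x - Y m))\<^sup>2 \<le> (d + 1 / real (Suc m))\<^sup>2" "(norm (x - Y n))\<^sup>2 \<le> (d + 1 / real (Suc n))\<^sup>2"
      using Y(2) less_imp_le by (auto intro!: power_mono)
    ultimately show ?thesis using parallelogram[of "x - Y m" "x - Y n"] by (simp add: power_mult_distrib)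
  qed
  have est2: "(norm (Y m - Y n))\<^sup>2 \<le> (8 * d + 4) * (1 / real (Suc N))" if "m \<ge> N" "n \<ge> N" for m n N
  proof -
    have a: "(d + 1 / real (Suc j))\<^sup>2 \<le> d\<^sup>2 + (2 * d + 1) * (1 / real (Suc N))" if "j \<ge> N" for j
    proof -
      define s where "s = 1 / real (Suc j)"
      have s: "0 \<le> s" "s \<le> 1 / real (Suc N)" "s \<le> 1"
        using that by (auto simp: s_def field_simps)
      have "(d + s)\<^sup>2 = d\<^sup>2 + (2 * d + s) * s" by (simp add: power2_eq_square algebra_simps)
      also have "\<dots> \<le> d\<^sup>2 + (2 * d + 1) * (1 / real (Suc N))"
        using s d0 by (intro add_left_mono mult_mono) auto
      finally show ?thesis unfolding s_def .
    qed
    show ?thesis using est[of m n] a[OF that(1)] a[OF that(2)] by argo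
  qed
  have "Cauchy Y"
  proof (rule CauchyI)
    fix e :: real assume "e > 0"
    then obtain N where N: "(8 * d + 4) / e\<^sup>2 < real N" using reals_Archimedean2 by blast
    show "\<exists>M. \<forall>m\<ge>M. \<forall>n\<ge>M. norm (Y m - Y n) < e"
    proof (intro exI allI impI)
      fix m n assume "N \<le> m" "N \<le> n"
      then have "(norm (Y m - Y n))\<^sup>2 \<le> (8 * d + 4) * (1 / real (Suc N))" by (rule est2)
      also have "\<dots> < e\<^sup>2"
      proof -
        have "(8 * d + 4) < e\<^sup>2 * real N" using N \<open>e > 0\<close> by (simp add: field_simps)
        also have "\<dots> \<le> e\<^sup>2 * real (Suc N)" by (intro mult_left_mono) auto
        finally show ?thesis by (simp add: field_simps)
      qed
      finally show "norm (Y m - Y n) < e" using \<open>e > 0\<close> power_less_imp_less_base by fastforce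
    qed
  qed
  then obtain y where y: "Y \<longlonglongrightarrow> y" using Cauchy_convergent convergent_def by blast
  have "y \<in> K" using K(2) Y(1) y closed_sequentially by blast
  moreover have "norm (x - y) \<le> d"
  proof (rule LIMSEQ_le)
    show "(\<lambda>n. norm (x - Y n)) \<longlonglongrightarrow> norm (x - y)" by (intro tendsto_intros y)
    have "(\<lambda>n. d + 1 / real (Suc n)) \<longlonglongrightarrow> d + 0"
      using lim_1_over_n LIMSEQ_Suc by (intro tendsto_intros) fast
    then show "(\<lambda>n. d + 1 / real (Suc n)) \<longlonglongrightarrow> d" by simp
  qed (use Y(2) less_imp_le in blast)
  ultimately show ?thesis using low order_trans by blast
qed

lemma orthogonal_projection_exists:
  fixes K :: "'a::{real_inner, complete_space} set"
  assumes K: "subspace K" "closed K"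
  shows "\<exists>y\<in>K. \<forall>k\<in>K. (x - y) \<bullet> k = 0"
proof -
  obtain y where y: "y \<in> K" "\<And>k. k \<in> K \<Longrightarrow> norm (x - y) \<le> norm (x - k)"
    using nearest_point_exists[OF K] by blast
  have "(x - y) \<bullet> k = 0" if k: "k \<in> K" for k
  proof (cases "k = 0")
    case False
    \<comment> \<open>The value of \<open>t\<close> that minimises
      \<open>norm (x - y - t *\<^sub>R k)\<close>. Since \<open>y\<close> is nearest, expanding the
      square leaves \<open>t\<^sup>2 * (k \<bullet> k) \<le> 0\<close>.\<close>
    define t where "t = ((x - y) \<bullet> k) / (k \<bullet> k)"
    have kk: "k \<bullet> k > 0" using False by simp
    have "y + t *\<^sub>R k \<in> K" using y(1) k K(1) by (simp add: subspace_add subspace_scale)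
    then have "norm (x - y) \<le> norm (x - (y + t *\<^sub>R k))" by (rule y(2))
    then have "(norm (x - y))\<^sup>2 \<le> (norm ((x - y) - t *\<^sub>R k))\<^sup>2"
      by (intro power_mono) (auto simp: algebra_simps)
    moreover have "(norm ((x - y) - t *\<^sub>R k))\<^sup>2
        = (norm (x - y))\<^sup>2 - 2 * t * ((x - y) \<bullet> k) + t\<^sup>2 * (k \<bullet> k)"
      using dot_norm_neg[of "x - y" "t *\<^sub>R k"] by (simp add: power_mult_distrib power2_norm_eq_inner)
    ultimately have "0 \<le> t\<^sup>2 * (k \<bullet> k) - 2 * t * ((x - y) \<bullet> k)" by linarith
    moreover have "(x - y) \<bullet> k = t * (k \<bullet> k)" using kk by (simp add: t_def)
    ultimately have "t\<^sup>2 * (k \<bullet> k) \<le> 0" by (simp add: power2_eq_square)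
    then have "t = 0" using kk by (metis mult_le_cancel_right_pos mult_zero_left power2_less_eq_zero_iff)
    then show ?thesis using kk by (simp add: t_def)
  qed simp
  then show ?thesis using y(1) by blast
qed

lemma closed_subspace_UNIV:
  fixes K :: "'a::{real_inner, complete_space} set"
  assumes "subspace K" "closed K" "\<And>x. (\<forall>k\<in>K. x \<bullet> k = 0) \<Longrightarrow> x = 0"
  shows "K = UNIV"
proof -
  have "x \<in> K" for x
    using orthogonal_projection_exists[OF assms(1,2), of x] assms(3) by force
  then show ?thesis by blast
qed

lemma riesz_representation:
  fixes f :: "'a::{real_inner, complete_space} \<Rightarrow> real"
  assumes f: "bounded_linear f"
  shows "\<exists>y. \<forall>x. f x = x \<bullet> y"
proof (cases "\<forall>x. f x = 0")
  case True
  then show ?thesis by (intro exI[of _ 0]) simp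
next
  case False
  interpret f: bounded_linear f by (rule f)
  define K where "K = {x. f x = 0}"
  have "subspace K" unfolding K_def by (simp add: subspace_def f.add f.scaleR f.zero)
  moreover have "closed K" unfolding K_def
    by (intro closed_Collect_eq f.continuous_on continuous_intros)
  ultimately obtain z where z: "z \<noteq> 0" "\<forall>k\<in>K. z \<bullet> k = 0"
    using closed_subspace_UNIV[of K] False unfolding K_def by blast
  then have fz: "f z \<noteq> 0" unfolding K_def by force
  have "f x = x \<bullet> ((f z / (z \<bullet> z)) *\<^sub>R z)" for x
  proof -
    have "x - (f x / f z) *\<^sub>R z \<in> K" unfolding K_def using fz by (simp add: f.diff f.scaleR)
    then have "z \<bullet> (x - (f x / f z) *\<^sub>R z) = 0" using z(2) by blast
    then show ?thesis using fz z(1) by (simp add: inner_diff_right inner_commute field_simps)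
  qed
  then show ?thesis by blast
qed

section \<open>Adjoints of bounded operators and their continuity in time\<close>

text \<open>\<open>adjoint\<close> is defined by a choice operator, so its characteristic identity
  holds only once some adjoint is known to exist; the Riesz representation supplies one.\<close>

lemma adjoint_blinfun:
  fixes B :: "'a::{real_inner, complete_space} \<Rightarrow>\<^sub>L 'b::real_inner"
  shows "x \<bullet> adjoint (blinfun_apply B) y = blinfun_apply B x \<bullet> y"
proof -
  have "\<exists>z. \<forall>x. blinfun_apply B x \<bullet> y = x \<bullet> z" for y
    by (rule riesz_representation)
      (intro bounded_linear_compose[OF bounded_linear_inner_left] blinfun.bounded_linear_right)
  then obtain g where "\<forall>x y. blinfun_apply B x \<bullet> y = x \<bullet> g y" by metis
  then have "\<forall>x y. blinfun_apply B x \<bullet> y = x \<bullet> adjoint (blinfun_apply B) y"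
    unfolding adjoint_def by (rule someI[where P = "\<lambda>f'. \<forall>x y. blinfun_apply B x \<bullet> y = x \<bullet> f' y"])
  then show ?thesis by simp
qed

text \<open>Pairing the difference with itself moves both adjoints to the other side, where only
  norms of \<open>B - C\<close> and \<open>C\<close> appear. The bound expresses joint continuity in
  the operator and the vector.\<close>

lemma norm_adjoint_blinfun_diff_le:
  fixes B C :: "'a::{real_inner, complete_space} \<Rightarrow>\<^sub>L 'b::real_inner"
  shows "norm (adjoint (blinfun_apply B) v - adjoint (blinfun_apply C) w)
    \<le> norm (B - C) * norm v + norm C * norm (v - w)"
proof -
  define d where "d = adjoint (blinfun_apply B) v - adjoint (blinfun_apply C) w"
  have "norm d * norm d = d \<bullet> d" by (simp add: dot_square_norm power2_eq_square)
  also have "d \<bullet> d = blinfun_apply (B - C) d \<bullet> v + blinfun_apply C d \<bullet> (v - w)"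
    by (subst (2) d_def)
      (simp add: inner_diff_right adjoint_blinfun blinfun.diff_left inner_diff_left)
  also have "\<dots> \<le> norm (B - C) * norm d * norm v + norm C * norm d * norm (v - w)"
    by (intro add_mono order_trans[OF norm_cauchy_schwarz] mult_right_mono norm_blinfun) auto
  also have "\<dots> = (norm (B - C) * norm v + norm C * norm (v - w)) * norm d"
    by (simp add: algebra_simps)
  finally show ?thesis
    unfolding d_def[symmetric] by (cases "d = 0") (simp, simp)
qed

lemma continuous_on_adjoint_blinfun:
  fixes F :: "real \<Rightarrow> ('a::{real_inner, complete_space} \<Rightarrow>\<^sub>L 'b::real_inner)"
  assumes "continuous_on I F" "continuous_on I v"
  shows "continuous_on I (\<lambda>t. adjoint (blinfun_apply (F t)) (v t))"
  unfolding continuous_on_def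
proof
  fix t assume t: "t \<in> I"
  have F: "(F \<longlongrightarrow> F t) (at t within I)" and v: "(v \<longlongrightarrow> v t) (at t within I)"
    using assms t by (auto simp: continuous_on_def)
  have "((\<lambda>s. norm (F s - F t) * norm (v s) + norm (F t) * norm (v s - v t))
      \<longlongrightarrow> norm (F t - F t) * norm (v t) + norm (F t) * norm (v t - v t)) (at t within I)"
    by (intro tendsto_intros F v)
  then have lim: "((\<lambda>s. norm (F s - F t) * norm (v s) + norm (F t) * norm (v s - v t)) \<longlongrightarrow> 0) (at t within I)"
    by simp
  show "((\<lambda>t. adjoint (blinfun_apply (F t)) (v t)) \<longlongrightarrow> adjoint (blinfun_apply (F t)) (v t)) (at t within I)"
    by (rule Lim_null[THEN iffD2], rule Lim_null_comparison[OF _ lim])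
      (simp add: norm_adjoint_blinfun_diff_le)
qed

section \<open>The inverse square root of \<open>A\<close> and the density of the span of its
  eigenvectors\<close>

lemma closure_subspace:
  fixes K :: "'a::real_normed_vector set"
  assumes K: "subspace K"
  shows "subspace (closure K)"
  unfolding subspace_def
proof (intro conjI ballI allI)
  show "0 \<in> closure K" using K closure_subset subspace_0 by blast
next
  fix x y assume "x \<in> closure K" "y \<in> closure K"
  then obtain X Y where "\<And>n. X n \<in> K" "X \<longlonglongrightarrow> x" "\<And>n. Y n \<in> K" "Y \<longlonglongrightarrow> y"
    unfolding closure_sequential by blast
  then have "\<forall>n. X n + Y n \<in> K" "(\<lambda>n. X n + Y n) \<longlonglongrightarrow> x + y"
    using K by (auto intro: subspace_add tendsto_add)
  then show "x + y \<in> closure K"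
    unfolding closure_sequential by (intro exI[of _ "\<lambda>n. X n + Y n"]) blast
next
  fix c :: real and x assume "x \<in> closure K"
  then obtain X where "\<And>n. X n \<in> K" "X \<longlonglongrightarrow> x"
    unfolding closure_sequential by blast
  then have "\<forall>n. c *\<^sub>R X n \<in> K" "(\<lambda>n. c *\<^sub>R X n) \<longlonglongrightarrow> c *\<^sub>R x"
    using K by (auto intro: subspace_scale tendsto_intros)
  then show "c *\<^sub>R x \<in> closure K"
    unfolding closure_sequential by (intro exI[of _ "\<lambda>n. c *\<^sub>R X n"]) blast
qed

text \<open>\<open>Q\<close> stands for the inverse \<open>A\<^sup>-\<^sup>1\<^sup>/\<^sup>2\<close> of \<open>S\<close>.\<close>

locale sqrt_inverse =
  fixes V :: "'h::{real_inner, complete_space} set" and S Q :: "'h \<Rightarrow> 'h"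
  assumes Q_bounded_linear: "bounded_linear Q"
    and Q_symmetric: "Q x \<bullet> y = x \<bullet> Q y"
    and Q_in_V: "Q x \<in> V"
    and S_Q: "S (Q x) = x"
    and Q_S: "x \<in> V \<Longrightarrow> Q (S x) = x"
    and Q_positive: "x \<noteq> 0 \<Longrightarrow> 0 < Q x \<bullet> x"
    and QQ_compact: "bounded X \<Longrightarrow> compact (closure ((\<lambda>x. Q (Q x)) ` X))"

text \<open>Positivity makes \<open>S\<close> injective on \<open>V\<close>, and it is onto because
  \<open>A = S \<circ> S\<close> is; hence \<open>Q\<close> is its inverse, and
  \<open>Q \<circ> Q\<close> is the compact inverse of \<open>A\<close>.\<close>

lemma sqrt_inverse_exists:
  fixes D :: "'h::{real_inner, complete_space} set"
  assumes A: "self_adjoint_op D A" "positive_op D A" "compact_inverse D A"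
    and S: "is_sqrt_op D A V S"
  shows "\<exists>Q. sqrt_inverse V S Q"
proof -
  have SV: "self_adjoint_op V S" "positive_op V S" and D: "D = {x \<in> V. S x \<in> V}"
    and AS: "\<And>x. x \<in> D \<Longrightarrow> A x = S (S x)"
    using S unfolding is_sqrt_op_def by blast+
  have V: "subspace V" and add: "\<And>x y. x \<in> V \<Longrightarrow> y \<in> V \<Longrightarrow> S (x + y) = S x + S y"
    and scale: "\<And>r x. x \<in> V \<Longrightarrow> S (r *\<^sub>R x) = r *\<^sub>R S x"
    and sym: "\<And>x y. x \<in> V \<Longrightarrow> y \<in> V \<Longrightarrow> S x \<bullet> y = x \<bullet> S y"
    using SV(1) unfolding self_adjoint_op_def densely_defined_linear_def by blast+
  have bij: "bij_betw A D UNIV"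
    and comp: "\<And>X. bounded X \<Longrightarrow> compact (closure (inv_into D A ` X))"
    using A(3) unfolding compact_inverse_def by blast+
  have S0: "x = 0" if "x \<in> V" "S x = 0" for x
    using that SV(2) unfolding positive_op_def by force
  have inj: "inj_on S V"
  proof (rule inj_onI)
    fix x y assume xy: "x \<in> V" "y \<in> V" "S x = S y"
    have "x + (- 1) *\<^sub>R y \<in> V" using xy V by (intro subspace_add subspace_scale)
    moreover have "S (x + (- 1) *\<^sub>R y) = 0"
      using xy V by (simp only: add scale subspace_scale) simp
    ultimately show "x = y" using S0 by fastforce
  qed
  define Q where "Q = inv_into V S"
  have surj: "y \<in> S ` V" for y
  proof -
    obtain x where "x \<in> D" "A x = y" using bij unfolding bij_betw_def by (metis UNIV_I imageE)
    then show ?thesis using D AS by force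
  qed
  have Q_in: "Q x \<in> V" and SQ: "S (Q x) = x" for x
    unfolding Q_def using surj by (auto intro: inv_into_into f_inv_into_f)
  have QS: "Q (S x) = x" if "x \<in> V" for x
    unfolding Q_def using inj that by simp
  have Q_add: "Q (x + y) = Q x + Q y" for x y
    using QS[of "Q x + Q y"] V Q_in SQ add by (simp add: subspace_add)
  have Q_scale: "Q (r *\<^sub>R x) = r *\<^sub>R Q x" for r x
    using QS[of "r *\<^sub>R Q x"] V Q_in SQ scale by (simp add: subspace_scale)
  have Q_sym: "Q x \<bullet> y = x \<bullet> Q y" for x y
    using sym[OF Q_in Q_in, of x y] by (simp add: SQ)
  have Q_pos: "0 < Q x \<bullet> x" if "x \<noteq> 0" for x
  proof -
    have "Q x \<noteq> 0" using that SQ Q_scale[of 0 0] by (metis scaleR_zero_left)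
    then show ?thesis using SV(2) Q_in[of x] SQ[of x] unfolding positive_op_def
      by (metis inner_commute)
  qed
  have QQ: "(\<lambda>x. Q (Q x)) = inv_into D A"
  proof
    fix x
    have "Q (Q x) \<in> D" "A (Q (Q x)) = x" using D AS Q_in SQ by auto
    then show "Q (Q x) = inv_into D A x"
      using bij unfolding bij_betw_def by (metis inv_into_f_f)
  qed
  have QQ_comp: "compact (closure ((\<lambda>x. Q (Q x)) ` X))" if "bounded X" for X
    unfolding QQ by (rule comp[OF that])
  \<comment> \<open>Boundedness of \<open>Q\<close> is inherited from its square: a relatively
    compact image of the unit ball bounds \<open>Q \<circ> Q\<close>, and
    \<open>(norm (Q x))\<^sup>2 = Q (Q x) \<bullet> x\<close>.\<close>
  have "bounded ((\<lambda>x. Q (Q x)) ` cball 0 1)"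
    by (rule bounded_subset[OF compact_imp_bounded[OF QQ_comp] closure_subset]) (rule bounded_cball)
  then obtain K where "\<forall>y\<in>(\<lambda>x. Q (Q x)) ` cball 0 1. norm y \<le> K"
    unfolding bounded_iff by blast
  then have K: "norm (Q (Q x)) \<le> K" if "norm x = 1" for x
    using that by simp
  have QQ_le: "norm (Q (Q x)) \<le> K * norm x" for x
  proof (cases "x = 0")
    case True
    then show ?thesis using Q_scale[of 0 0] by simp
  next
    case False
    then have "norm (Q (Q ((1 / norm x) *\<^sub>R x))) \<le> K" by (intro K) simp
    then show ?thesis using False by (simp add: Q_scale field_simps)
  qed
  have "bounded_linear Q"
  proof (rule bounded_linear_intro[of _ "sqrt \<bar>K\<bar>"])
    fix x
    have "(norm (Q x))\<^sup>2 = Q (Q x) \<bullet> x" by (simp add: power2_norm_eq_inner Q_sym)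
    also have "\<dots> \<le> K * norm x * norm x"
      by (rule order_trans[OF norm_cauchy_schwarz]) (intro mult_right_mono QQ_le norm_ge_zero)
    also have "\<dots> \<le> \<bar>K\<bar> * norm x * norm x"
      by (intro mult_right_mono) auto
    finally have "norm (Q x) \<le> sqrt (\<bar>K\<bar> * (norm x * norm x))"
      by (intro real_le_rsqrt) (simp add: mult.assoc)
    then show "norm (Q x) \<le> norm x * sqrt \<bar>K\<bar>" by (simp add: real_sqrt_mult mult.commute)
  qed (simp_all add: Q_add Q_scale)
  then have "sqrt_inverse V S Q"
    using Q_sym Q_in SQ QS Q_pos QQ_comp by (rule sqrt_inverse.intro)
  then show ?thesis by blast
qed

context sqrt_inverse
begin

sublocale Q: bounded_linear Q by (rule Q_bounded_linear)

lemma Q_eq_0_iff: "Q x = 0 \<longleftrightarrow> x = 0"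
  using Q_positive[of x] Q.zero by force

lemma S_symmetric: "x \<in> V \<Longrightarrow> y \<in> V \<Longrightarrow> S x \<bullet> y = x \<bullet> S y"
  by (metis Q_S Q_symmetric)

lemma V_add: "x \<in> V \<Longrightarrow> y \<in> V \<Longrightarrow> x + y \<in> V"
  by (metis Q.add Q_S Q_in_V)

lemma V_scale: "x \<in> V \<Longrightarrow> r *\<^sub>R x \<in> V"
  by (metis Q.scaleR Q_S Q_in_V)

lemma V_diff: "x \<in> V \<Longrightarrow> y \<in> V \<Longrightarrow> x - y \<in> V"
  by (metis Q.diff Q_S Q_in_V)

lemma S_add: "x \<in> V \<Longrightarrow> y \<in> V \<Longrightarrow> S (x + y) = S x + S y"
  by (metis Q.add Q_S S_Q)

lemma S_scale: "x \<in> V \<Longrightarrow> S (r *\<^sub>R x) = r *\<^sub>R S x"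
  by (metis Q.scaleR Q_S S_Q)

lemma S_diff: "x \<in> V \<Longrightarrow> y \<in> V \<Longrightarrow> S (x - y) = S x - S y"
  by (metis Q.diff Q_S S_Q)

text \<open>\<open>Q \<circ> Q - \<mu>\<close> factors as
  \<open>(Q + sqrt \<mu>) (Q - sqrt \<mu>)\<close>, and positivity of \<open>Q\<close> makes the
  first factor injective.\<close>

lemma Q_eigenvector_of_square:
  assumes e: "Q (Q e) = \<mu> *\<^sub>R e" "e \<noteq> 0"
  shows "\<mu> > 0" "Q e = sqrt \<mu> *\<^sub>R e"
proof -
  have "\<mu> * (e \<bullet> e) = Q e \<bullet> Q e" using e(1) by (simp add: Q_symmetric)
  moreover have "Q e \<bullet> Q e > 0" using e(2) Q_eq_0_iff by simp
  ultimately show \<mu>: "\<mu> > 0" using inner_ge_zero[of e] by (metis mult_le_0_iff not_less)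
  define z where "z = Q e - sqrt \<mu> *\<^sub>R e"
  have "Q z = - (sqrt \<mu> *\<^sub>R z)"
    using e(1) \<mu> by (simp add: z_def Q.diff Q.scaleR scaleR_diff_right)
  then have "Q z \<bullet> z = - sqrt \<mu> * (z \<bullet> z)" by simp
  also have "\<dots> \<le> 0" using \<mu> by simp
  finally have "z = 0" using Q_positive[of z] by force
  then show "Q e = sqrt \<mu> *\<^sub>R e" by (simp add: z_def)
qed

text \<open>An eigenvector of \<open>Q\<close> for \<open>l\<close> is one of \<open>A\<close> for
  \<open>1 / l^2\<close>, so that a free wave along it has frequency \<open>1 / l\<close>. The zero
  vector is included; it starts the inductions over the span.\<close>

definition eigenvectors :: "'h set" where
  "eigenvectors = {e. \<exists>l>0. Q e = l *\<^sub>R e}"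

text \<open>A maximiser \<open>x\<close> of \<open>norm (Q (Q x))\<close> on the unit ball of \<open>K\<close> satisfies
  \<open>(R - s) (R + s) x = 0\<close> with \<open>R = Q \<circ> Q\<close> and \<open>s\<close> the maximum.\<close>

lemma eigenvector_in_invariant_subspace:
  assumes K: "subspace K" "closed K" "\<And>x. x \<in> K \<Longrightarrow> Q x \<in> K" and k: "k \<in> K" "k \<noteq> 0"
  shows "\<exists>e\<in>K. e \<noteq> 0 \<and> e \<in> eigenvectors"
proof -
  define R where "R = (\<lambda>x. Q (Q x))"
  have R: "bounded_linear R" unfolding R_def
    by (intro bounded_linear_compose[OF Q_bounded_linear] Q_bounded_linear)
  interpret R: bounded_linear R by (rule R)
  have R_sym: "R x \<bullet> y = x \<bullet> R y" for x y unfolding R_def by (simp add: Q_symmetric)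
  have RK: "R x \<in> K" if "x \<in> K" for x unfolding R_def using K(3) that by blast
  define C where "C = closure (R ` (K \<inter> cball 0 1))"
  have C: "compact C" unfolding C_def R_def by (rule QQ_compact) (simp add: bounded_Int)
  have CK: "C \<subseteq> K" unfolding C_def using RK K(2) by (intro closure_minimal) auto
  have inC: "R x \<in> C" if "x \<in> K" "norm x \<le> 1" for x
    unfolding C_def using that by (intro subsetD[OF closure_subset]) auto
  have "C \<noteq> {}" using inC[of 0] K(1) subspace_0 by auto
  \<comment> \<open>Compactness gives an element of largest norm, so that \<open>s\<close> is the
    norm of \<open>R\<close> on \<open>K\<close>. At this point \<open>y\<close> is only a limit of
    values \<open>R (X n)\<close>.\<close>
  then obtain y where y: "y \<in> C" "\<And>w. w \<in> C \<Longrightarrow> norm w \<le> norm y"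
    using continuous_attains_sup[OF C, of norm] continuous_on_norm_id by blast
  define s where "s = norm y"
  have R_le: "norm (R x) \<le> s * norm x" if "x \<in> K" for x
  proof (cases "x = 0")
    case False
    have "R ((1 / norm x) *\<^sub>R x) \<in> C" using that False K(1) by (intro inC) (auto simp: subspace_scale)
    then have "norm (R ((1 / norm x) *\<^sub>R x)) \<le> s" unfolding s_def by (rule y(2))
    then show ?thesis using False by (simp add: R.scaleR field_simps)
  qed (simp add: R.zero)
  have s: "s > 0"
  proof -
    have "R k \<noteq> 0" using k(2) by (simp add: R_def Q_eq_0_iff)
    then have "0 < s * norm k" using R_le[OF k(1)] by (metis less_le_trans zero_less_norm_iff)
    then show ?thesis using k(2) by (simp add: zero_less_mult_iff)
  qed
  obtain X where X: "\<And>n. X n \<in> K" "\<And>n. norm (X n) \<le> 1" "(\<lambda>n. R (X n)) \<longlonglongrightarrow> y"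
  proof -
    obtain Y where Y: "\<And>n. Y n \<in> R ` (K \<inter> cball 0 1)" "Y \<longlonglongrightarrow> y"
      using y(1) unfolding C_def closure_sequential by blast
    then have "\<exists>x. Y n = R x \<and> x \<in> K \<and> norm x \<le> 1" for n by fastforce
    then obtain X where "\<And>n. Y n = R (X n) \<and> X n \<in> K \<and> norm (X n) \<le> 1" by metis
    moreover from this have "Y = (\<lambda>n. R (X n))" by auto
    ultimately show ?thesis using that[of X] Y(2) by simp
  qed
  \<comment> \<open>So far only \<open>R (X n)\<close> is known to converge. As
    \<open>R (R (X n)) - s\<^sup>2 *\<^sub>R X n\<close> tends to 0, the sequence \<open>X\<close>
    itself converges, with this limit; \<open>x\<close> is then the maximiser.\<close>
  define x where "x = (1 / s\<^sup>2) *\<^sub>R R y"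
  have "(\<lambda>n. R (R (X n)) - s\<^sup>2 *\<^sub>R X n) \<longlonglongrightarrow> 0"
  proof (rule Lim_null_comparison)
    show "\<forall>\<^sub>F n in sequentially. norm (R (R (X n)) - s\<^sup>2 *\<^sub>R X n)
        \<le> sqrt (s ^ 4 - s\<^sup>2 * (norm (R (X n)))\<^sup>2)"
    proof (intro always_eventually allI real_le_rsqrt)
      fix n
      have "(norm (R (R (X n)) - s\<^sup>2 *\<^sub>R X n))\<^sup>2
          = (norm (R (R (X n))))\<^sup>2 + (s\<^sup>2)\<^sup>2 * (norm (X n))\<^sup>2 - 2 * (s\<^sup>2 * (R (R (X n)) \<bullet> X n))"
        using dot_norm_neg[of "R (R (X n))" "s\<^sup>2 *\<^sub>R X n"] by (simp add: power_mult_distrib)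
      also have "R (R (X n)) \<bullet> X n = (norm (R (X n)))\<^sup>2"
        by (simp add: R_sym power2_norm_eq_inner)
      also have "(norm (R (R (X n))))\<^sup>2 \<le> (s * norm (R (X n)))\<^sup>2"
        using R_le RK X(1) by (intro power_mono) auto
      also have "(s\<^sup>2)\<^sup>2 * (norm (X n))\<^sup>2 \<le> (s\<^sup>2)\<^sup>2 * 1"
        using X(2) by (intro mult_left_mono power_le_one) auto
      finally show "(norm (R (R (X n)) - s\<^sup>2 *\<^sub>R X n))\<^sup>2 \<le> s ^ 4 - s\<^sup>2 * (norm (R (X n)))\<^sup>2"
        by (simp add: power_mult_distrib)
    qed
    have "(\<lambda>n. sqrt (s ^ 4 - s\<^sup>2 * (norm (R (X n)))\<^sup>2)) \<longlonglongrightarrow> sqrt (s ^ 4 - s\<^sup>2 * (norm y)\<^sup>2)"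
      by (intro tendsto_intros X(3))
    then show "(\<lambda>n. sqrt (s ^ 4 - s\<^sup>2 * (norm (R (X n)))\<^sup>2)) \<longlonglongrightarrow> 0"
      by (simp add: s_def flip: power_add)
  qed
  then have "(\<lambda>n. (1 / s\<^sup>2) *\<^sub>R (R (R (X n)) - (R (R (X n)) - s\<^sup>2 *\<^sub>R X n))) \<longlonglongrightarrow> (1 / s\<^sup>2) *\<^sub>R (R y - 0)"
    by (intro tendsto_intros R.tendsto X(3))
  then have Xx: "X \<longlonglongrightarrow> x" using s by (simp add: x_def)
  then have xK: "x \<in> K" using K(2) X(1) closed_sequentially by blast
  have "R x = y" using R.tendsto[OF Xx] X(3) LIMSEQ_unique by blast
  then have Rx: "R (R x) = s\<^sup>2 *\<^sub>R x" "x \<noteq> 0"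
    using s by (auto simp: x_def s_def R.zero)
  \<comment> \<open>The sign of the eigenvalue stays open here;
    \<open>Q_eigenvector_of_square\<close> shows it to be positive and passes from \<open>R\<close>
    to \<open>Q\<close>.\<close>
  have "\<exists>e\<in>K. e \<noteq> 0 \<and> (\<exists>\<mu>. R e = \<mu> *\<^sub>R e)"
  proof (cases "R x + s *\<^sub>R x = 0")
    case True
    then have "R x = (- s) *\<^sub>R x" by (simp add: eq_neg_iff_add_eq_0)
    then show ?thesis using xK Rx(2) by blast
  next
    case False
    have "R (R x + s *\<^sub>R x) = s *\<^sub>R (R x + s *\<^sub>R x)"
      using Rx(1) by (simp add: R.add R.scaleR scaleR_add_right power2_eq_square)
    moreover have "R x + s *\<^sub>R x \<in> K" using xK RK K(1) by (simp add: subspace_add subspace_scale)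
    ultimately show ?thesis using False by blast
  qed
  then obtain e \<mu> where e: "e \<in> K" "e \<noteq> 0" "Q (Q e) = \<mu> *\<^sub>R e" unfolding R_def by blast
  then have "e \<in> eigenvectors"
    using Q_eigenvector_of_square[OF e(3,2)] unfolding eigenvectors_def by auto
  then show ?thesis using e by blast
qed

text \<open>The orthogonal complement of the eigenvectors is closed and invariant under
  \<open>Q\<close>. Were it nonzero, it would contain a nonzero eigenvector, which would be
  orthogonal to itself.\<close>

lemma eigenvectors_dense: "closure (span eigenvectors) = UNIV"
proof (rule closed_subspace_UNIV)
  fix x assume x: "\<forall>k\<in>closure (span eigenvectors). x \<bullet> k = 0"
  define K where "K = {x. \<forall>e\<in>eigenvectors. x \<bullet> e = 0}"
  have "subspace K" unfolding K_def by (simp add: subspace_def inner_add_left)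
  moreover have "closed K" unfolding K_def
    by (simp only: Ball_def, intro closed_Collect_all closed_Collect_imp closed_Collect_eq
        open_Collect_const continuous_intros)
  moreover have "Q x \<in> K" if "x \<in> K" for x
    unfolding K_def using that Q_symmetric by (auto simp: K_def eigenvectors_def)
  moreover have "x \<in> K" unfolding K_def
    using x closure_subset[of "span eigenvectors"] span_superset[of eigenvectors] by blast
  ultimately have "x = 0 \<or> (\<exists>e\<in>K. e \<noteq> 0 \<and> e \<in> eigenvectors)"
    using eigenvector_in_invariant_subspace by blast
  then show "x = 0" by (auto simp: K_def)
qed (simp_all add: closed_closure closure_subspace)

end

section \<open>Smoothing operators with range in the domain of \<open>A\<close>\<close>

text \<open>Division by \<open>K\<^sup>2\<close> makes \<open>T\<close> a contraction which
  multiplies an eigenvector by \<open>1 - l^2 / K^2\<close>, a number in [0,1). So the powers vanish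
  in the limit on the span of the eigenvectors, and the uniform bound extends this to the
  closure.\<close>

lemma (in sqrt_inverse) contraction_powers_tendsto_0:
  assumes K: "K > 0" "\<And>x. norm (Q x) \<le> K * norm x"
  defines "T \<equiv> \<lambda>x. x - (1 / K\<^sup>2) *\<^sub>R Q (Q x)"
  shows "norm ((T ^^ k) x) \<le> norm x" "(\<lambda>k. (T ^^ k) x) \<longlonglongrightarrow> 0"
proof -
  have T: "bounded_linear T" unfolding T_def
    by (intro bounded_linear_sub bounded_linear_ident bounded_linear_scaleR_right
        bounded_linear_compose[OF bounded_linear_scaleR_right]
        bounded_linear_compose[OF Q_bounded_linear] Q_bounded_linear)
  interpret T: bounded_linear T by (rule T)
  have T_le: "norm (T x) \<le> norm x" for x
  proof (rule power2_le_imp_le)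
    have "(norm (T x))\<^sup>2 = (norm x)\<^sup>2 + (norm (Q (Q x)) / K\<^sup>2)\<^sup>2 - 2 * (norm (Q x))\<^sup>2 / K\<^sup>2"
      using dot_norm_neg[of x "(1 / K\<^sup>2) *\<^sub>R Q (Q x)"] K(1)
      by (simp add: T_def power_mult_distrib power_divide power2_norm_eq_inner[of "Q x"] Q_symmetric)
    moreover have "(norm (Q (Q x)) / K\<^sup>2)\<^sup>2 \<le> (K * norm (Q x) / K\<^sup>2)\<^sup>2"
      using K by (intro power_mono divide_right_mono) auto
    moreover have "(K * norm (Q x) / K\<^sup>2)\<^sup>2 = (norm (Q x))\<^sup>2 / K\<^sup>2"
      using K(1) by (simp add: power2_eq_square)
    moreover have "0 \<le> (norm (Q x))\<^sup>2 / K\<^sup>2" by simp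
    ultimately show "(norm (T x))\<^sup>2 \<le> (norm x)\<^sup>2" by linarith
  qed simp
  show Tk_le: "norm ((T ^^ k) x) \<le> norm x" for k x
    by (induction k) (auto intro: order_trans[OF T_le])
  have Tk_add: "(T ^^ k) (x + y) = (T ^^ k) x + (T ^^ k) y" for k x y
    by (induction k) (simp_all add: T.add)
  have Tk_scale: "(T ^^ k) (r *\<^sub>R x) = r *\<^sub>R (T ^^ k) x" for k r x
    by (induction k) (simp_all add: T.scaleR)
  define Z where "Z = {x. (\<lambda>k. (T ^^ k) x) \<longlonglongrightarrow> 0}"
  have "subspace Z" unfolding subspace_def
  proof (intro conjI ballI allI)
    show "0 \<in> Z" using Tk_scale[of _ 0 0] by (simp add: Z_def)
    show "x + y \<in> Z" if "x \<in> Z" "y \<in> Z" for x y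
      using that tendsto_add[of "\<lambda>k. (T ^^ k) x" 0 _ "\<lambda>k. (T ^^ k) y" 0] by (simp add: Z_def Tk_add)
    show "r *\<^sub>R x \<in> Z" if "x \<in> Z" for r x
      using that tendsto_scaleR[OF tendsto_const, of "\<lambda>k. (T ^^ k) x" 0 _ r] by (simp add: Z_def Tk_scale)
  qed
  moreover have "eigenvectors \<subseteq> Z"
  proof
    fix e assume "e \<in> eigenvectors"
    then obtain l where l: "l > 0" "Q e = l *\<^sub>R e" unfolding eigenvectors_def by blast
    define q where "q = 1 - l\<^sup>2 / K\<^sup>2"
    show "e \<in> Z"
    proof (cases "e = 0")
      case True
      then show ?thesis using Tk_scale[of _ 0 0] by (simp add: Z_def)
    next
      case False
      have "l * norm e \<le> K * norm e" using K(2)[of e] l by simp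
      then have "l \<le> K" using False by simp
      then have "l\<^sup>2 \<le> K\<^sup>2" using l(1) by (intro power_mono) auto
      then have q: "0 \<le> q" "q < 1" using l(1) K(1) by (auto simp: q_def)
      have "T e = q *\<^sub>R e"
        using l by (simp add: T_def q_def Q.scaleR scaleR_diff_left power2_eq_square)
      then have "(T ^^ k) e = q ^ k *\<^sub>R e" for k
        by (induction k) (simp_all add: T.scaleR mult.commute)
      moreover have "(\<lambda>k. q ^ k *\<^sub>R e) \<longlonglongrightarrow> 0 *\<^sub>R e"
        using q by (intro tendsto_intros LIMSEQ_power_zero) auto
      ultimately show ?thesis by (simp add: Z_def)
    qed
  qed
  ultimately have "span eigenvectors \<subseteq> Z" by (rule span_minimal[rotated])
  moreover have "closed Z"
    unfolding closed_sequential_limits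
  proof (intro allI impI, elim conjE)
    fix X x assume X: "\<forall>n. X n \<in> Z" "X \<longlonglongrightarrow> x"
    show "x \<in> Z" unfolding Z_def mem_Collect_eq
    proof (rule LIMSEQ_I)
      fix r :: real assume r: "0 < r"
      then obtain n where n: "norm (X n - x) < r / 2"
        using LIMSEQ_D[OF X(2), of "r / 2"] by auto
      have "(\<lambda>k. (T ^^ k) (X n)) \<longlonglongrightarrow> 0" using X(1) unfolding Z_def by blast
      then obtain k0 where k0: "\<And>k. k \<ge> k0 \<Longrightarrow> norm ((T ^^ k) (X n)) < r / 2"
        using LIMSEQ_D[of _ 0 "r / 2"] r by auto
      show "\<exists>no. \<forall>k\<ge>no. norm ((T ^^ k) x - 0) < r"
      proof (intro exI allI impI)
        fix k assume "k0 \<le> k"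
        have "(T ^^ k) x = (T ^^ k) (X n) + (T ^^ k) (x - X n)" by (simp flip: Tk_add)
        then have "norm ((T ^^ k) x) \<le> norm ((T ^^ k) (X n)) + norm ((T ^^ k) (x - X n))"
          by (metis norm_triangle_ineq)
        also have "\<dots> < r / 2 + r / 2"
          using k0[OF \<open>k0 \<le> k\<close>] Tk_le[of k "x - X n"] n by (simp add: norm_minus_commute)
        finally show "norm ((T ^^ k) x - 0) < r" by simp
      qed
    qed
  qed
  ultimately have "closure (span eigenvectors) \<subseteq> Z" by (rule closure_minimal)
  then show "(\<lambda>k. (T ^^ k) x) \<longlonglongrightarrow> 0" for x using eigenvectors_dense by (auto simp: Z_def)
qed

text \<open>With \<open>R = Q \<circ> Q = A\<^sup>-\<^sup>1\<close> and \<open>T = 1 - R / K\<^sup>2\<close>, the smoothing operators are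
  \<open>R \<circ> L\<^sub>k = 1 - T ^ k\<close>, where \<open>L\<^sub>k\<close> is a polynomial in \<open>R\<close>.\<close>

lemma (in sqrt_inverse) smoothing_operators_exist:
  "\<exists>L. \<forall>k. bounded_linear (L k) \<and> (\<forall>x. L k (Q x) = Q (L k x)) \<and> (\<forall>x y. L k x \<bullet> y = x \<bullet> L k y)
     \<and> (\<forall>x. norm (Q (Q (L k x))) \<le> 2 * norm x) \<and> (\<forall>x. (\<lambda>k. Q (Q (L k x))) \<longlonglongrightarrow> x)"
proof -
  obtain K where K: "K > 0" "\<And>x. norm (Q x) \<le> K * norm x"
    using Q.pos_bounded by (metis mult.commute)
  define T where "T = (\<lambda>x. x - (1 / K\<^sup>2) *\<^sub>R Q (Q x))"
  \<comment> \<open>Iterating from 0 gives the geometric sum of \<open>T ^^ j\<close> for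
    \<open>j < k\<close>, divided by \<open>K\<^sup>2\<close>. As \<open>Q \<circ> Q\<close> is
    \<open>K\<^sup>2\<close> times \<open>1 - T\<close>, composing with it telescopes to
    \<open>1 - T ^^ k\<close>.\<close>
  define L where "L = (\<lambda>k x. ((\<lambda>y. (1 / K\<^sup>2) *\<^sub>R x + T y) ^^ k) 0)"
  have L_0: "L 0 x = 0" and L_Suc: "L (Suc k) x = (1 / K\<^sup>2) *\<^sub>R x + T (L k x)" for k x
    by (simp_all add: L_def)
  have T: "bounded_linear T" unfolding T_def
    by (intro bounded_linear_sub bounded_linear_ident
        bounded_linear_compose[OF bounded_linear_scaleR_right]
        bounded_linear_compose[OF Q_bounded_linear] Q_bounded_linear)
  interpret T: bounded_linear T by (rule T)
  have TQ: "T (Q x) = Q (T x)" for x by (simp add: T_def Q.diff Q.scaleR)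
  have T_sym: "T x \<bullet> y = x \<bullet> T y" for x y
    by (simp add: T_def inner_diff_left inner_diff_right Q_symmetric)
  have L_bl: "bounded_linear (L k)" for k
  proof (induction k)
    case 0
    have "L 0 = (\<lambda>x. 0)" by (simp add: fun_eq_iff L_0)
    then show ?case by simp
  next
    case (Suc k)
    have "L (Suc k) = (\<lambda>x. (1 / K\<^sup>2) *\<^sub>R x + T (L k x))" by (simp add: fun_eq_iff L_Suc)
    then show ?case
      by (simp only:) (intro bounded_linear_add bounded_linear_scaleR_right bounded_linear_compose[OF T] Suc)
  qed
  have LQ: "L k (Q x) = Q (L k x)" for k x
    by (induction k) (simp_all add: L_0 L_Suc TQ Q.zero Q.add Q.scaleR)
  have L_sym: "L k x \<bullet> y = x \<bullet> L k y" for k x y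
  proof (induction k arbitrary: x y)
    case (Suc k)
    have TL: "T (L k x) = L k (T x)" for k x
      by (simp add: T_def linear_diff linear_scale bounded_linear.linear[OF L_bl] LQ)
    show ?case by (simp add: L_Suc inner_add_left inner_add_right T_sym Suc TL)
  qed (simp add: L_0)
  have RL: "Q (Q (L k x)) = x - (T ^^ k) x" for k x
  proof (induction k)
    case (Suc k)
    have "Q (Q (L (Suc k) x)) = (1 / K\<^sup>2) *\<^sub>R Q (Q x) + T (Q (Q (L k x)))"
      by (simp add: L_Suc Q.add Q.scaleR TQ)
    also have "\<dots> = x - T ((T ^^ k) x)"
      by (simp add: Suc T.diff) (simp add: T_def)
    finally show ?case by simp
  qed (simp add: L_0 Q.zero)
  note Tk = contraction_powers_tendsto_0[OF K, folded T_def]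
  have "norm (Q (Q (L k x))) \<le> 2 * norm x" for k x
    unfolding RL using norm_triangle_ineq4[of x "(T ^^ k) x"] Tk(1)[of k x] by linarith
  moreover have "(\<lambda>k. Q (Q (L k x))) \<longlonglongrightarrow> x" for x
    unfolding RL using tendsto_diff[OF tendsto_const Tk(2)] by simp
  ultimately show ?thesis using L_bl LQ L_sym by blast
qed

section \<open>Weak solutions on a single interval and the energy identity\<close>

text \<open>Continuity is required on the closed interval, the equation only inside it. The
  endpoints can therefore be switching times, and values of \<open>f\<close> there do not
  matter.\<close>

definition wave_on ::
    "'h::real_inner set \<Rightarrow> ('h \<Rightarrow> 'h) \<Rightarrow> real \<Rightarrow> real \<Rightarrow> (real \<Rightarrow> 'h)
      \<Rightarrow> (real \<Rightarrow> 'h) \<Rightarrow> (real \<Rightarrow> 'h) \<Rightarrow> bool" where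
  "wave_on V S a b f u ut \<longleftrightarrow>
     (\<forall>t\<in>{a..b}. u t \<in> V) \<and> continuous_on {a..b} (\<lambda>t. S (u t)) \<and> continuous_on {a..b} ut \<and>
     (\<forall>t\<in>{a<..<b}. (u has_vector_derivative ut t) (at t)) \<and>
     (\<forall>t\<in>{a<..<b}. \<forall>v\<in>V. ((\<lambda>s. ut s \<bullet> v) has_real_derivative (f t \<bullet> v - S (u t) \<bullet> S v)) (at t))"

lemma wave_on_subinterval:
  assumes "wave_on V S a b f u ut" "a \<le> c" "d \<le> b"
  shows "wave_on V S c d f u ut"
  using assms unfolding wave_on_def
  by (auto elim: continuous_on_subset)

lemma wave_on_cong:
  assumes "wave_on V S a b f u ut" "\<And>t. t \<in> {a<..<b} \<Longrightarrow> f t = g t"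
  shows "wave_on V S a b g u ut"
  using assms unfolding wave_on_def by simp

text \<open>A weak derivative that is continuous in norm is a strong one: the mean value theorem is
  applied to the inner product with \<open>v\<close>, where \<open>v\<close> is the remainder of the
  first-order expansion itself.\<close>

lemma has_vector_derivative_weak:
  fixes g :: "real \<Rightarrow> 'a::real_inner"
  assumes t: "t \<in> {a<..<b}"
    and g: "\<And>s v. s \<in> {a<..<b} \<Longrightarrow> ((\<lambda>r. g r \<bullet> v) has_real_derivative (g' s \<bullet> v)) (at s)"
    and g': "isCont g' t"
  shows "(g has_vector_derivative g' t) (at t)"
  unfolding has_vector_derivative_def has_derivative_at_alt
proof (intro conjI bounded_linear_scaleR_left allI impI)
  fix e :: real assume "0 < e"
  then obtain d0 where d0: "d0 > 0" "\<And>s. norm (s - t) < d0 \<Longrightarrow> norm (g' s - g' t) < e"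
    using g' unfolding continuous_at_eps_delta dist_norm by blast
  define d where "d = Min {d0, t - a, b - t}"
  show "\<exists>d>0. \<forall>y. norm (y - t) < d \<longrightarrow> norm (g y - g t - (y - t) *\<^sub>R g' t) \<le> e * norm (y - t)"
  proof (intro exI conjI allI impI)
    show "d > 0" using t d0(1) by (simp add: d_def)
    fix s assume "norm (s - t) < d"
    then have s: "norm (s - t) < d0" "s \<in> {a<..<b}" by (auto simp: d_def)
    define v where "v = g s - g t - (s - t) *\<^sub>R g' t"
    have "\<exists>\<xi>. norm (\<xi> - t) < d0 \<and> (g s - g t) \<bullet> v = (s - t) * (g' \<xi> \<bullet> v)"
    proof (cases s t rule: linorder_cases)
      case less
      have "\<exists>\<xi>>s. \<xi> < t \<and> g t \<bullet> v - g s \<bullet> v = (t - s) * (g' \<xi> \<bullet> v)"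
        using less s(2) t by (intro MVT2 g) auto
      then obtain \<xi> where "s < \<xi>" "\<xi> < t" "g t \<bullet> v - g s \<bullet> v = (t - s) * (g' \<xi> \<bullet> v)" by blast
      then show ?thesis using s(1)
        by (intro exI[of _ \<xi>]) (auto simp: inner_diff_left algebra_simps)
    next
      case equal
      then show ?thesis using d0(1) by (intro exI[of _ t]) simp
    next
      case greater
      have "\<exists>\<xi>>t. \<xi> < s \<and> g s \<bullet> v - g t \<bullet> v = (s - t) * (g' \<xi> \<bullet> v)"
        using greater s(2) t by (intro MVT2 g) auto
      then obtain \<xi> where "t < \<xi>" "\<xi> < s" "g s \<bullet> v - g t \<bullet> v = (s - t) * (g' \<xi> \<bullet> v)" by blast
      then show ?thesis using s(1)
        by (intro exI[of _ \<xi>]) (auto simp: inner_diff_left)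
    qed
    then obtain \<xi> where \<xi>: "norm (\<xi> - t) < d0" "(g s - g t) \<bullet> v = (s - t) * (g' \<xi> \<bullet> v)" by blast
    have "norm v * norm v = v \<bullet> v" by (simp add: dot_square_norm power2_eq_square)
    also have "\<dots> = (s - t) * ((g' \<xi> - g' t) \<bullet> v)"
      using \<xi>(2) by (subst v_def) (simp add: inner_diff_left right_diff_distrib)
    also have "\<dots> \<le> \<bar>s - t\<bar> * (norm (g' \<xi> - g' t) * norm v)"
      by (rule order_trans[OF abs_ge_self]) (simp add: abs_mult mult_left_mono Cauchy_Schwarz_ineq2)
    also have "\<dots> \<le> \<bar>s - t\<bar> * (e * norm v)"
      using d0(2)[OF \<xi>(1)] by (intro mult_left_mono mult_right_mono) auto
    also have "\<dots> = (e * norm (s - t)) * norm v" by simp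
    finally have "norm v \<le> e * norm (s - t)"
      using \<open>0 < e\<close> by (cases "v = 0") (simp, metis mult_le_cancel_right_pos zero_less_norm_iff)
    then show "norm (g s - g t - (s - t) *\<^sub>R g' t) \<le> e * norm (s - t)" unfolding v_def .
  qed
qed

text \<open>Smoothing maps the solution into the domain of \<open>A\<close>, where the energy can be
  differentiated; the identity then passes to the limit.\<close>

lemma (in sqrt_inverse) energy_identity:
  assumes w: "wave_on V S a b f u ut" and f: "continuous_on {a..b} f" and ab: "a \<le> b"
  shows "std_energy S u ut b - std_energy S u ut a = integral {a..b} (\<lambda>t. f t \<bullet> ut t)"
proof -
  have uV: "\<And>t. t \<in> {a..b} \<Longrightarrow> u t \<in> V" and Su: "continuous_on {a..b} (\<lambda>t. S (u t))"
    and ut: "continuous_on {a..b} ut"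
    and du: "\<And>t. t \<in> {a<..<b} \<Longrightarrow> (u has_vector_derivative ut t) (at t)"
    and dut: "\<And>t v. t \<in> {a<..<b} \<Longrightarrow> v \<in> V \<Longrightarrow>
      ((\<lambda>s. ut s \<bullet> v) has_real_derivative (f t \<bullet> v - S (u t) \<bullet> S v)) (at t)"
    using w unfolding wave_on_def by blast+
  have u: "continuous_on {a..b} u"
    using Q.continuous_on[OF Su] by (rule continuous_on_eq) (simp add: Q_S uV)
  obtain L where L: "\<And>k. bounded_linear (L k)" and LQ: "\<And>k x. L k (Q x) = Q (L k x)"
    and L_sym: "\<And>k x y. L k x \<bullet> y = x \<bullet> L k y"
    and J_le: "\<And>k x. norm (Q (Q (L k x))) \<le> 2 * norm x"
    and J_lim: "\<And>x. (\<lambda>k. Q (Q (L k x))) \<longlonglongrightarrow> x"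
    using smoothing_operators_exist by blast
  define J where "J = (\<lambda>k x. Q (Q (L k x)))"
  have J: "bounded_linear (J k)" for k unfolding J_def
    by (intro bounded_linear_compose[OF Q_bounded_linear] L)
  define en where "en = (\<lambda>k t. ((norm (J k (S (u t))))\<^sup>2 + (norm (J k (ut t)))\<^sup>2) / 2)"
  have ident: "((\<lambda>t. J k (f t) \<bullet> J k (ut t)) has_integral (en k b - en k a)) {a..b}" for k
  proof (rule fundamental_theorem_of_calculus_interior[OF ab])
    have JS: "continuous_on {a..b} (\<lambda>t. J k (S (u t)))" and Jt: "continuous_on {a..b} (\<lambda>t. J k (ut t))"
      using bounded_linear.continuous_on[OF J] Su ut by blast+
    then show "continuous_on {a..b} (en k)" unfolding en_def by (intro continuous_intros) auto
    fix t assume t: "t \<in> {a<..<b}"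
    have QL: "bounded_linear (\<lambda>x. Q (L k x))" by (intro bounded_linear_compose[OF Q_bounded_linear] L)
    \<comment> \<open>On the interval this equals \<open>J k (S (u t))\<close>, so its norm is the
      \<open>V\<close>-norm part of the smoothed energy; written through \<open>u\<close>, it can be
      differentiated.\<close>
    define x where "x = (\<lambda>t. Q (L k (u t)))"
    define y where "y = (\<lambda>t. J k (ut t))"
    have dx: "(x has_vector_derivative Q (L k (ut t))) (at t)" unfolding x_def
      by (rule bounded_linear.has_vector_derivative[OF QL du[OF t]])
    \<comment> \<open>Formally the derivative is \<open>J k\<close> applied to
      \<open>f - A u\<close>, and the factor \<open>Q \<circ> Q\<close> of \<open>J k\<close>
      cancels \<open>A\<close>. Rigorously, the equation is tested with
      \<open>Q (Q (L k v))\<close>, which lies in \<open>V\<close> for every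
      \<open>v\<close>.\<close>
    have dy: "(y has_vector_derivative (J k (f t) - L k (u t))) (at t)"
    proof (rule has_vector_derivative_weak[OF t])
      fix s v assume s: "s \<in> {a<..<b}"
      have "y r \<bullet> v = ut r \<bullet> Q (Q (L k v))" for r
        by (simp add: y_def J_def Q_symmetric L_sym LQ)
      moreover have "f s \<bullet> Q (Q (L k v)) - S (u s) \<bullet> S (Q (Q (L k v))) = (J k (f s) - L k (u s)) \<bullet> v"
        using s uV[of s] by (simp add: S_Q J_def inner_diff_left Q_symmetric L_sym LQ S_symmetric Q_in_V)
      ultimately show "((\<lambda>r. y r \<bullet> v) has_real_derivative ((J k (f s) - L k (u s)) \<bullet> v)) (at s)"
        using dut[OF s Q_in_V, of "Q (L k v)"] by simp
    next
      have "continuous_on {a..b} (\<lambda>t. J k (f t) - L k (u t))"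
        using bounded_linear.continuous_on[OF J f] bounded_linear.continuous_on[OF L u]
        by (intro continuous_intros)
      then show "isCont (\<lambda>t. J k (f t) - L k (u t)) t"
        using t by (intro continuous_on_interior[of "{a..b}"]) auto
    qed
    have "((\<lambda>s. (x s \<bullet> x s + y s \<bullet> y s) / 2) has_vector_derivative
        ((x t \<bullet> Q (L k (ut t)) + Q (L k (ut t)) \<bullet> x t)
          + (y t \<bullet> (J k (f t) - L k (u t)) + (J k (f t) - L k (u t)) \<bullet> y t)) / 2) (at t)"
      by (intro has_vector_derivative_divide has_vector_derivative_add
          bounded_bilinear.has_vector_derivative[OF bounded_bilinear_inner] dx dy)
    also have "((x t \<bullet> Q (L k (ut t)) + Q (L k (ut t)) \<bullet> x t)
          + (y t \<bullet> (J k (f t) - L k (u t)) + (J k (f t) - L k (u t)) \<bullet> y t)) / 2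
        = J k (f t) \<bullet> J k (ut t)"
    proof -
      \<comment> \<open>The exchange between potential and kinetic energy: these terms cancel, and
        only the power of \<open>f\<close> remains.\<close>
      have "y t \<bullet> L k (u t) = x t \<bullet> Q (L k (ut t))"
        by (simp add: x_def y_def J_def Q_symmetric inner_commute)
      then show ?thesis by (simp add: inner_diff_left inner_diff_right inner_commute y_def)
    qed
    finally have "((\<lambda>s. (x s \<bullet> x s + y s \<bullet> y s) / 2) has_vector_derivative J k (f t) \<bullet> J k (ut t)) (at t)" .
    moreover have "(x s \<bullet> x s + y s \<bullet> y s) / 2 = en k s" if "s \<in> {a<..<b}" for s
    proof -
      have "x s = J k (S (u s))" using uV[of s] that by (simp add: x_def J_def LQ[symmetric] Q_S)
      then show ?thesis by (simp add: en_def y_def power2_norm_eq_inner)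
    qed
    ultimately show "(en k has_vector_derivative J k (f t) \<bullet> J k (ut t)) (at t)"
      using t by (auto elim!: has_vector_derivative_transform_within_open[where S = "{a<..<b}"])
  qed
  have J_lim': "(\<lambda>k. J k x) \<longlonglongrightarrow> x" for x unfolding J_def by (rule J_lim)
  have en_lim: "(\<lambda>k. en k t) \<longlonglongrightarrow> std_energy S u ut t" for t
    using tendsto_divide[OF tendsto_add[OF tendsto_power tendsto_power] tendsto_const,
        OF tendsto_norm[OF J_lim'] tendsto_norm[OF J_lim'], of 2 "S (u t)" 2 "ut t" 2]
    by (simp add: en_def std_energy_def normV_def)
  \<comment> \<open>\<open>J k\<close> converges only pointwise; the uniform bound 2 on its norm
    supplies the dominating function.\<close>
  have "(\<lambda>k. integral {a..b} (\<lambda>t. J k (f t) \<bullet> J k (ut t))) \<longlonglongrightarrow> integral {a..b} (\<lambda>t. f t \<bullet> ut t)"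
  proof (rule dominated_convergence)
    show "(\<lambda>t. J k (f t) \<bullet> J k (ut t)) integrable_on {a..b}" for k
      using ident by (rule has_integral_integrable)
    show "(\<lambda>t. (2 * norm (f t)) * (2 * norm (ut t))) integrable_on {a..b}"
      by (intro integrable_continuous_real continuous_intros f ut)
    show "norm (J k (f t) \<bullet> J k (ut t)) \<le> (2 * norm (f t)) * (2 * norm (ut t))" for k t
      unfolding real_norm_def J_def
      by (rule order_trans[OF Cauchy_Schwarz_ineq2]) (intro mult_mono J_le, auto)
    show "(\<lambda>k. J k (f t) \<bullet> J k (ut t)) \<longlonglongrightarrow> f t \<bullet> ut t" for t
      by (intro tendsto_inner J_lim')
  qed
  moreover have "integral {a..b} (\<lambda>t. J k (f t) \<bullet> J k (ut t)) = en k b - en k a" for k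
    using ident by (rule integral_unique)
  ultimately show ?thesis
    using LIMSEQ_unique[OF tendsto_diff[OF en_lim en_lim]] by force
qed

section \<open>Operations on weak solutions, and free waves with dense initial data\<close>

lemma weak_wave_solution_imp_wave_on:
  assumes w: "weak_wave_solution V S N f u0 u1 u ut" and a: "0 \<le> a" and N: "{a<..<b} \<inter> N = {}"
  shows "wave_on V S a b f u ut"
  unfolding wave_on_def
proof (intro conjI ballI)
  have sub: "{a..b} \<subseteq> {0..}" using a by auto
  show "continuous_on {a..b} (\<lambda>t. S (u t))" "continuous_on {a..b} ut"
    using w sub unfolding weak_wave_solution_def by (blast intro: continuous_on_subset)+
  show "u t \<in> V" if "t \<in> {a..b}" for t
    using w that a unfolding weak_wave_solution_def by simp
  fix t assume t: "t \<in> {a<..<b}"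
  then have t0: "t > 0" "t \<notin> N" using a N by auto
  have "(u has_vector_derivative ut t) (at t within {0..})"
    using w t0 unfolding weak_wave_solution_def by simp
  then show "(u has_vector_derivative ut t) (at t)"
    using t0(1) at_within_interior[of t "{0..}"] by (simp add: interior_real_atLeast)
  show "((\<lambda>s. ut s \<bullet> v) has_real_derivative (f t \<bullet> v - S (u t) \<bullet> S v)) (at t)" if "v \<in> V" for v
    using w t0 that unfolding weak_wave_solution_def by blast
qed

lemma wave_on_shift:
  assumes w: "wave_on V S a b f u ut"
  shows "wave_on V S 0 (b - a) (\<lambda>t. f (a + t)) (\<lambda>t. u (a + t)) (\<lambda>t. ut (a + t))"
  unfolding wave_on_def
proof (intro conjI ballI)
  have im: "continuous_on {0..b - a} (\<lambda>t. a + t)" "(\<lambda>t. a + t) ` {0..b - a} \<subseteq> {a..b}"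
    by (auto intro!: continuous_intros)
  show "u (a + t) \<in> V" if "t \<in> {0..b - a}" for t
    using w that unfolding wave_on_def by auto
  show "continuous_on {0..b - a} (\<lambda>t. S (u (a + t)))" "continuous_on {0..b - a} (\<lambda>t. ut (a + t))"
    using w continuous_on_compose2[OF _ im] unfolding wave_on_def by blast+
  fix t assume "t \<in> {0<..<b - a}"
  then have t: "a + t \<in> {a<..<b}" by auto
  have shift: "((\<lambda>s. a + s) has_vector_derivative 1) (at t)"
    by (auto intro!: derivative_eq_intros)
  have "(u has_vector_derivative ut (a + t)) (at (a + t))"
    using w t unfolding wave_on_def by blast
  then show "((\<lambda>s. u (a + s)) has_vector_derivative ut (a + t)) (at t)"
    using vector_diff_chain_at[OF shift] by (simp add: o_def)
  fix v assume "v \<in> V"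
  then have "((\<lambda>s. ut s \<bullet> v) has_real_derivative (f (a + t) \<bullet> v - S (u (a + t)) \<bullet> S v)) (at (t + a))"
    using w t unfolding wave_on_def by (simp add: add.commute)
  then show "((\<lambda>s. ut (a + s) \<bullet> v) has_real_derivative (f (a + t) \<bullet> v - S (u (a + t)) \<bullet> S v)) (at t)"
    by (simp add: DERIV_shift add.commute[of a])
qed

context sqrt_inverse
begin

lemma wave_on_diff:
  assumes u: "wave_on V S a b f u ut" and w: "wave_on V S a b g w wt"
  shows "wave_on V S a b (\<lambda>t. f t - g t) (\<lambda>t. u t - w t) (\<lambda>t. ut t - wt t)"
  unfolding wave_on_def
proof (intro conjI ballI)
  have V: "u t \<in> V" "w t \<in> V" if "t \<in> {a..b}" for t
    using u w that unfolding wave_on_def by auto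
  then show "u t - w t \<in> V" if "t \<in> {a..b}" for t
    using that by (simp add: V_diff)
  have "continuous_on {a..b} (\<lambda>t. S (u t) - S (w t))"
    using u w unfolding wave_on_def by (intro continuous_on_diff) blast+
  then show "continuous_on {a..b} (\<lambda>t. S (u t - w t))"
    by (rule continuous_on_eq) (simp add: S_diff V)
  show "continuous_on {a..b} (\<lambda>t. ut t - wt t)"
    using u w unfolding wave_on_def by (intro continuous_on_diff) blast+
  fix t assume t: "t \<in> {a<..<b}"
  show "((\<lambda>t. u t - w t) has_vector_derivative ut t - wt t) (at t)"
    using u w t unfolding wave_on_def by (intro has_vector_derivative_diff) blast+
  fix v assume v: "v \<in> V"
  have "((\<lambda>s. ut s \<bullet> v - wt s \<bullet> v) has_real_derivative
      (f t \<bullet> v - S (u t) \<bullet> S v) - (g t \<bullet> v - S (w t) \<bullet> S v)) (at t)"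
    using u w t v unfolding wave_on_def by (intro DERIV_diff) blast+
  then show "((\<lambda>s. (ut s - wt s) \<bullet> v) has_real_derivative
      (f t - g t) \<bullet> v - S (u t - w t) \<bullet> S v) (at t)"
    using V t by (simp add: inner_diff_left S_diff algebra_simps)
qed

lemma free_wave_solution_add:
  assumes u: "free_wave_solution V S u0 u1 u ut" and w: "free_wave_solution V S w0 w1 w wt"
  shows "free_wave_solution V S (u0 + w0) (u1 + w1) (\<lambda>t. u t + w t) (\<lambda>t. ut t + wt t)"
  unfolding free_wave_solution_def weak_wave_solution_def
proof (intro conjI allI impI ballI)
  note us = u[unfolded free_wave_solution_def weak_wave_solution_def]
  note ws = w[unfolded free_wave_solution_def weak_wave_solution_def]
  have V: "u t \<in> V" "w t \<in> V" if "0 \<le> t" for t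
    using us ws that by auto
  then show "u t + w t \<in> V" if "0 \<le> t" for t
    using that by (simp add: V_add)
  have "continuous_on {0..} (\<lambda>t. S (u t) + S (w t))"
    using us ws by (intro continuous_on_add) blast+
  then show "continuous_on {0..} (\<lambda>t. S (u t + w t))"
    by (rule continuous_on_eq) (simp add: S_add V)
  show "continuous_on {0..} (\<lambda>t. ut t + wt t)"
    using us ws by (intro continuous_on_add) blast+
  show "u 0 + w 0 = u0 + w0" "ut 0 + wt 0 = u1 + w1"
    using us ws by simp_all
  show "((\<lambda>t. u t + w t) has_vector_derivative ut t + wt t) (at t within {0..})" if "0 \<le> t" for t
    using us ws that by (intro has_vector_derivative_add) blast+
  fix t :: real and v assume t: "0 < t" and v: "v \<in> V"
  have "((\<lambda>s. ut s \<bullet> v + wt s \<bullet> v) has_real_derivative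
      (0 \<bullet> v - S (u t) \<bullet> S v) + (0 \<bullet> v - S (w t) \<bullet> S v)) (at t)"
    using us ws t v by (intro DERIV_add) blast+
  then show "((\<lambda>s. (ut s + wt s) \<bullet> v) has_real_derivative 0 \<bullet> v - S (u t + w t) \<bullet> S v) (at t)"
    using V[of t] t by (simp add: inner_add_left S_add algebra_simps)
qed

text \<open>Along an eigenvector the equation is a harmonic oscillator. The first datum is
  prescribed through \<open>S w0\<close>, since this is what the norm of \<open>V\<close>
  measures.\<close>

lemma free_wave_of_eigenvector:
  assumes e: "e \<in> eigenvectors"
  shows "\<exists>w0 w wt. free_wave_solution V S w0 (\<beta> *\<^sub>R e) w wt \<and> S w0 = \<alpha> *\<^sub>R e"
proof -
  obtain l where l: "l > 0" "Q e = l *\<^sub>R e" using e unfolding eigenvectors_def by blast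
  have le: "l *\<^sub>R e \<in> V" "S (l *\<^sub>R e) = e" using Q_in_V[of e] S_Q[of e] l by auto
  have "(1 / l) *\<^sub>R (l *\<^sub>R e) \<in> V" using V_scale[OF le(1)] by blast
  then have eV: "e \<in> V" using l(1) by simp
  have "S e = (1 / l) *\<^sub>R l *\<^sub>R S e" using l(1) by simp
  also have "l *\<^sub>R S e = e" using le(2) S_scale[OF eV] by simp
  finally have Se: "S e = (1 / l) *\<^sub>R e" .
  \<comment> \<open>\<open>p\<close> and \<open>q\<close> are the coefficients of \<open>S w\<close>
    and \<open>wt\<close> along \<open>e\<close>; the pair rotates with angular frequency
    \<open>1 / l\<close>. The wave itself carries a factor \<open>l\<close>, because
    \<open>S (l *\<^sub>R e) = e\<close>.\<close>
  define p where "p = (\<lambda>t. \<alpha> * cos (t / l) + \<beta> * sin (t / l))"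
  define q where "q = (\<lambda>t. - \<alpha> * sin (t / l) + \<beta> * cos (t / l))"
  have p: "(p has_real_derivative q t / l) (at t)" and q: "(q has_real_derivative - p t / l) (at t)" for t
    unfolding p_def q_def using l(1)
    by (auto intro!: derivative_eq_intros simp: field_simps)
  have Sp: "S (p t *\<^sub>R l *\<^sub>R e) = p t *\<^sub>R e" for t
    using S_scale[OF le(1)] le(2) by metis
  have "free_wave_solution V S (\<alpha> *\<^sub>R l *\<^sub>R e) (\<beta> *\<^sub>R e) (\<lambda>t. p t *\<^sub>R l *\<^sub>R e) (\<lambda>t. q t *\<^sub>R e)"
    unfolding free_wave_solution_def weak_wave_solution_def
  proof (intro conjI allI impI ballI)
    show "p t *\<^sub>R l *\<^sub>R e \<in> V" for t by (rule V_scale[OF le(1)])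
    show "continuous_on {0..} (\<lambda>t. S (p t *\<^sub>R l *\<^sub>R e))" "continuous_on {0..} (\<lambda>t. q t *\<^sub>R e)"
      unfolding Sp unfolding p_def q_def using l(1) by (auto intro!: continuous_intros)
    show "p 0 *\<^sub>R l *\<^sub>R e = \<alpha> *\<^sub>R l *\<^sub>R e" "q 0 *\<^sub>R e = \<beta> *\<^sub>R e"
      by (simp_all add: p_def q_def)
    show "((\<lambda>t. p t *\<^sub>R l *\<^sub>R e) has_vector_derivative q t *\<^sub>R e) (at t within {0..})" for t
    proof -
      have "((\<lambda>t. p t *\<^sub>R l *\<^sub>R e) has_vector_derivative p t *\<^sub>R 0 + (q t / l) *\<^sub>R l *\<^sub>R e) (at t)"
        by (intro has_vector_derivative_scaleR p has_vector_derivative_const)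
      then show ?thesis using l(1) by (auto intro: has_vector_derivative_at_within)
    qed
    fix t :: real and v assume v: "v \<in> V"
    have "((\<lambda>s. q s * (e \<bullet> v)) has_real_derivative (- p t / l) * (e \<bullet> v)) (at t)"
      by (intro DERIV_cmult_right q)
    moreover have "e \<bullet> S v = (1 / l) * (e \<bullet> v)"
      using S_symmetric[OF eV v] by (simp add: Se)
    ultimately show "((\<lambda>s. (q s *\<^sub>R e) \<bullet> v) has_real_derivative 0 \<bullet> v - S (p t *\<^sub>R l *\<^sub>R e) \<bullet> S v) (at t)"
      unfolding Sp by simp
  qed
  moreover have "S (\<alpha> *\<^sub>R l *\<^sub>R e) = \<alpha> *\<^sub>R e" using S_scale[OF le(1)] le(2) by metis
  ultimately show ?thesis by blast
qed

lemma free_wave_of_span: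
  assumes "x \<in> span eigenvectors" "y \<in> span eigenvectors"
  shows "\<exists>w0 w wt. free_wave_solution V S w0 y w wt \<and> S w0 = x"
proof -
  have V: "w0 \<in> V" if "free_wave_solution V S w0 w1 w wt" for w0 w1 w wt
    using that unfolding free_wave_solution_def weak_wave_solution_def by auto
  have add: "\<exists>w0 w wt. free_wave_solution V S w0 (y + y') w wt \<and> S w0 = x + x'"
    if "\<exists>w0 w wt. free_wave_solution V S w0 y w wt \<and> S w0 = x"
      "\<exists>w0 w wt. free_wave_solution V S w0 y' w wt \<and> S w0 = x'" for x y x' y'
    using that free_wave_solution_add S_add V by meson
  have zero: "0 \<in> eigenvectors" by (auto simp: eigenvectors_def Q.zero intro: exI[of _ 1])
  have "\<exists>w0 w wt. free_wave_solution V S w0 0 w wt \<and> S w0 = x"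
    using assms(1)
  proof (induction rule: span_induct_alt)
    case base
    then show ?case using free_wave_of_eigenvector[OF zero, of 0 0] by simp
  next
    case (step c e x)
    then show ?case using add[OF free_wave_of_eigenvector[OF step(1), of 0 c] step(2)] by simp
  qed
  moreover have "\<exists>w0 w wt. free_wave_solution V S w0 y w wt \<and> S w0 = 0"
    using assms(2)
  proof (induction rule: span_induct_alt)
    case base
    then show ?case using free_wave_of_eigenvector[OF zero, of 0 0] by simp
  next
    case (step c e x)
    then show ?case using add[OF free_wave_of_eigenvector[OF step(1), of c 0] step(2)] by simp
  qed
  ultimately show ?thesis using add by fastforce
qed

text \<open>Convergence is in the energy norm of the data, with \<open>S (u 0)\<close> and
  \<open>ut 0\<close> as the later choice of \<open>x\<close> and \<open>y\<close>. No limit wave is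
  asserted; only integral bounds for the approximating waves will pass to the limit.\<close>

lemma free_wave_data_dense:
  "\<exists>w0 w1 w wt. (\<forall>n::nat. free_wave_solution V S (w0 n) (w1 n) (w n) (wt n))
     \<and> (\<lambda>n. S (w0 n)) \<longlonglongrightarrow> x \<and> w1 \<longlonglongrightarrow> y"
proof -
  have "x \<in> closure (span eigenvectors)" "y \<in> closure (span eigenvectors)"
    using eigenvectors_dense by auto
  then obtain X Y where X: "\<And>n. X n \<in> span eigenvectors" "X \<longlonglongrightarrow> x"
    and Y: "\<And>n. Y n \<in> span eigenvectors" "Y \<longlonglongrightarrow> y"
    unfolding closure_sequential by blast
  have "\<forall>n. \<exists>w0 w wt. free_wave_solution V S w0 (Y n) w wt \<and> S w0 = X n"
    using free_wave_of_span[OF X(1) Y(1)] by blast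
  then obtain w0 w wt where "\<And>n. free_wave_solution V S (w0 n) (Y n) (w n) (wt n) \<and> S (w0 n) = X n"
    by metis
  then show ?thesis using X(2) Y(2) by (intro exI[of _ w0] exI[of _ Y] exI[of _ w] exI[of _ wt]) simp
qed

section \<open>Even intervals: dissipation, observability and contraction\<close>

lemma energy_identity_on_subinterval:
  assumes "wave_on V S a b f u ut" "continuous_on {a..b} f" "t \<in> {a..b}"
  shows "std_energy S u ut t = std_energy S u ut a + integral {a..t} (\<lambda>s. f s \<bullet> ut s)"
proof -
  have "wave_on V S a t f u ut" using assms(1,3) by (auto intro: wave_on_subinterval)
  moreover have "continuous_on {a..t} f" using assms(3) by (auto intro: continuous_on_subset[OF assms(2)])
  ultimately show ?thesis using energy_identity[of a t f u ut] assms(3) by simp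
qed

lemma damped_energy:
  fixes B :: "real \<Rightarrow> ('u::{real_inner, complete_space} \<Rightarrow>\<^sub>L 'h)"
  assumes B: "continuous_on {a..b} B"
    and u: "wave_on V S a b (\<lambda>t. - blinfun_apply (B t) (adjoint (blinfun_apply (B t)) (ut t))) u ut"
    and t: "t \<in> {a..b}"
  shows "std_energy S u ut t = std_energy S u ut a
    - integral {a..t} (\<lambda>s. (norm (adjoint (blinfun_apply (B s)) (ut s)))\<^sup>2)"
    "std_energy S u ut t \<le> std_energy S u ut a"
proof -
  have ut: "continuous_on {a..b} ut" using u unfolding wave_on_def by blast
  have adj: "continuous_on {a..b} (\<lambda>t. adjoint (blinfun_apply (B t)) (ut t))"
    by (rule continuous_on_adjoint_blinfun[OF B ut])
  have cont: "continuous_on {a..b} (\<lambda>t. - blinfun_apply (B t) (adjoint (blinfun_apply (B t)) (ut t)))"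
    by (intro continuous_on_minus blinfun.continuous_on B adj)
  have "(\<lambda>s. (- blinfun_apply (B s) (adjoint (blinfun_apply (B s)) (ut s))) \<bullet> ut s)
      = (\<lambda>s. - (norm (adjoint (blinfun_apply (B s)) (ut s)))\<^sup>2)"
    by (simp add: fun_eq_iff power2_norm_eq_inner flip: adjoint_blinfun)
  then show *: "std_energy S u ut t = std_energy S u ut a
    - integral {a..t} (\<lambda>s. (norm (adjoint (blinfun_apply (B s)) (ut s)))\<^sup>2)"
    using energy_identity_on_subinterval[OF u cont t] by simp
  have "0 \<le> integral {a..t} (\<lambda>s. (norm (adjoint (blinfun_apply (B s)) (ut s)))\<^sup>2)"
    using t by (intro integral_nonneg integrable_continuous_real continuous_on_power continuous_on_norm
        continuous_on_subset[OF adj]) auto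
  then show "std_energy S u ut t \<le> std_energy S u ut a" using * by linarith
qed

text \<open>Comparison of the damped wave \<open>u\<close> with a free wave \<open>w\<close> whose data differ from those of
  \<open>u\<close> by energy \<open>e\<close>; in the limit \<open>e \<rightarrow> 0\<close> it replaces the free wave with the same data.\<close>

lemma damped_wave_observability_approx:
  fixes B :: "real \<Rightarrow> ('u::{real_inner, complete_space} \<Rightarrow>\<^sub>L 'h)"
    and \<iota> :: "'h \<Rightarrow> 'w::real_inner"
  assumes T: "0 < T" and B: "continuous_on {0..T} B"
    and u: "wave_on V S 0 T (\<lambda>t. - blinfun_apply (B t) (adjoint (blinfun_apply (B t)) (ut t))) u ut"
    and w: "wave_on V S 0 T (\<lambda>t. 0) w wt"
    and \<iota>: "bounded_linear \<iota>" "C > 0" "\<And>v. (norm (\<iota> v))\<^sup>2 \<le> C * (norm v)\<^sup>2"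
    and m: "0 < m" "m \<le> M"
    and lower: "\<And>t v. t \<in> {0..T} \<Longrightarrow> m * (norm (\<iota> v))\<^sup>2 \<le> (norm (adjoint (blinfun_apply (B t)) v))\<^sup>2"
    and upper: "\<And>t v. t \<in> {0..T} \<Longrightarrow> (norm (adjoint (blinfun_apply (B t)) v))\<^sup>2 \<le> M * (norm (\<iota> v))\<^sup>2"
  defines "e \<equiv> std_energy S (\<lambda>t. u t - w t) (\<lambda>t. ut t - wt t) 0"
  shows "integral {0..T} (\<lambda>s. (norm (\<iota> (wt s)))\<^sup>2)
    \<le> 2 / m * (1 + 4 * C\<^sup>2 * T\<^sup>2 * M\<^sup>2) * (std_energy S u ut 0 - std_energy S u ut T) + 8 * C * T * e"
proof -
  interpret \<iota>: bounded_linear \<iota> by (rule \<iota>(1))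
  define f where "f = (\<lambda>t. - blinfun_apply (B t) (adjoint (blinfun_apply (B t)) (ut t)))"
  define z where "z = (\<lambda>t. u t - w t)"
  define zt where "zt = (\<lambda>t. ut t - wt t)"
  define a where "a = (\<lambda>t. adjoint (blinfun_apply (B t)) (ut t))"
  \<comment> \<open>The weight in Young's inequality, chosen so that \<open>Z\<close> returns with
    coefficient 1/2 after integration over {0..T} and can be absorbed.\<close>
  define \<kappa> where "\<kappa> = 2 * C * T"
  define X where "X = integral {0..T} (\<lambda>s. (norm (\<iota> (ut s)))\<^sup>2)"
  define Y where "Y = integral {0..T} (\<lambda>s. (norm (a s))\<^sup>2)"
  define Z where "Z = integral {0..T} (\<lambda>s. (norm (\<iota> (zt s)))\<^sup>2)"
  have \<kappa>: "\<kappa> > 0" using \<iota>(2) T by (simp add: \<kappa>_def)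
  have M: "M > 0" using m by linarith
  have z: "wave_on V S 0 T f z zt"
    using wave_on_diff[OF u w] by (simp add: f_def z_def zt_def)
  have ut: "continuous_on {0..T} ut" and wt: "continuous_on {0..T} wt" and zt: "continuous_on {0..T} zt"
    using u w z unfolding wave_on_def by blast+
  have a: "continuous_on {0..T} a"
    unfolding a_def by (rule continuous_on_adjoint_blinfun[OF B ut])
  have f: "continuous_on {0..T} f"
    unfolding f_def by (intro continuous_on_minus blinfun.continuous_on B a[unfolded a_def])
  have int: "(\<lambda>s. (norm (\<iota> (ut s)))\<^sup>2) integrable_on {0..T}" "(\<lambda>s. (norm (\<iota> (wt s)))\<^sup>2) integrable_on {0..T}"
      "(\<lambda>s. (norm (\<iota> (zt s)))\<^sup>2) integrable_on {0..T}" "(\<lambda>s. (norm (a s))\<^sup>2) integrable_on {0..T}"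
    by (intro integrable_continuous_real continuous_intros \<iota>.continuous_on ut wt zt a)+
  have Y: "Y = std_energy S u ut 0 - std_energy S u ut T"
    using damped_energy(1)[OF B u, of T] T by (simp add: Y_def a_def)
  have "0 \<le> Y" unfolding Y_def by (rule integral_nonneg[OF int(4)]) simp
  have z_energy: "std_energy S z zt t \<le> e + (\<kappa> * M * Y + Z / \<kappa>) / 2" if t: "t \<in> {0..T}" for t
  proof -
    define h where "h = (\<lambda>s. (\<kappa> * M * (norm (a s))\<^sup>2 + (norm (\<iota> (zt s)))\<^sup>2 / \<kappa>) / 2)"
    have h: "continuous_on {0..T} h"
      unfolding h_def using \<kappa> by (intro continuous_intros \<iota>.continuous_on zt a) auto
    have sub: "{0..t} \<subseteq> {0..T}" using t by auto
    have le: "f s \<bullet> zt s \<le> h s" if s: "s \<in> {0..T}" for s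
    proof -
      define b where "b = adjoint (blinfun_apply (B s)) (zt s)"
      have "f s \<bullet> zt s = - (a s \<bullet> b)"
        unfolding f_def b_def a_def by (simp add: adjoint_blinfun)
      also have "\<dots> \<le> norm (a s) * norm b"
        using norm_cauchy_schwarz[of "- a s" b] by simp
      \<comment> \<open>Young's inequality with weight \<open>\<kappa> * M\<close>; the factor
        \<open>M\<close> then cancels against the upper bound for \<open>norm b\<close>, leaving a
        term in \<open>\<iota> (zt s)\<close> that is free of \<open>M\<close>.\<close>
      also have "\<dots> \<le> (\<kappa> * M * (norm (a s))\<^sup>2 + (norm b)\<^sup>2 / (\<kappa> * M)) / 2"
      proof -
        have "0 \<le> (\<kappa> * M * norm (a s) - norm b)\<^sup>2 / (\<kappa> * M)" using \<kappa> M by simp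
        also have "\<dots> = \<kappa> * M * (norm (a s))\<^sup>2 + (norm b)\<^sup>2 / (\<kappa> * M) - 2 * (norm (a s) * norm b)"
          using \<kappa> M by (simp add: power2_eq_square field_simps)
        finally show ?thesis
          using divide_right_mono[of "2 * (norm (a s) * norm b)" _ 2] by simp
      qed
      also have "(norm b)\<^sup>2 / (\<kappa> * M) \<le> (M * (norm (\<iota> (zt s)))\<^sup>2) / (\<kappa> * M)"
        using upper[OF s, of "zt s"] \<kappa> M unfolding b_def by (intro divide_right_mono) auto
      finally show ?thesis using M by (simp add: h_def)
    qed
    have "std_energy S z zt t = e + integral {0..t} (\<lambda>s. f s \<bullet> zt s)"
      using energy_identity_on_subinterval[OF z f t] by (simp add: e_def z_def zt_def)
    also have "integral {0..t} (\<lambda>s. f s \<bullet> zt s) \<le> integral {0..t} h"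
      using sub le by (intro integral_le integrable_continuous_real continuous_intros
          continuous_on_subset[OF f sub] continuous_on_subset[OF zt sub] continuous_on_subset[OF h sub]) auto
    also have "\<dots> \<le> integral {0..T} h"
      using \<kappa> M by (intro integral_subset_le sub integrable_continuous_real
          continuous_on_subset[OF h sub] h) (simp add: h_def)
    also have "\<dots> = (\<kappa> * M * Y + Z / \<kappa>) / 2"
      unfolding h_def Y_def Z_def using int
      by (simp add: integral_add integrable_on_mult_right integrable_on_divide)
    finally show ?thesis by simp
  qed
  have "Z \<le> integral {0..T} (\<lambda>s. 2 * C * (e + (\<kappa> * M * Y + Z / \<kappa>) / 2))"
  proof (subst (1) Z_def, rule integral_le[OF int(3)])
    fix s assume s: "s \<in> {0..T}"
    have "(norm (\<iota> (zt s)))\<^sup>2 \<le> C * (norm (zt s))\<^sup>2" by (rule \<iota>(3))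
    also have "\<dots> \<le> C * (2 * std_energy S z zt s)"
      using \<iota>(2) by (intro mult_left_mono) (auto simp: std_energy_def)
    also have "\<dots> = 2 * C * std_energy S z zt s" by simp
    also have "\<dots> \<le> 2 * C * (e + (\<kappa> * M * Y + Z / \<kappa>) / 2)"
      using \<iota>(2) z_energy[OF s] by (intro mult_left_mono) auto
    finally show "(norm (\<iota> (zt s)))\<^sup>2 \<le> 2 * C * (e + (\<kappa> * M * Y + Z / \<kappa>) / 2)" .
  qed (rule integrable_const_ivl)
  also have "\<dots> = \<kappa> * e + \<kappa>\<^sup>2 * M * Y / 2 + Z / 2"
    using T \<iota>(2) by (simp add: \<kappa>_def power2_eq_square field_simps)
  finally have Z: "Z \<le> 2 * \<kappa> * e + \<kappa>\<^sup>2 * M * Y" by simp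
  \<comment> \<open>\<open>M\<close> is traded for \<open>M\<^sup>2 / m\<close>, so that this term
    and the bound \<open>Y / m\<close> for \<open>X\<close> have the common denominator that appears
    in \<open>c_hat\<close>.\<close>
  have "M * m \<le> M\<^sup>2" using m M by (simp add: power2_eq_square)
  then have "M \<le> M\<^sup>2 / m" using m(1) by (simp add: field_simps)
  then have "\<kappa>\<^sup>2 * Y * M \<le> \<kappa>\<^sup>2 * Y * (M\<^sup>2 / m)"
    using \<open>0 \<le> Y\<close> by (intro mult_left_mono) auto
  with Z have Z': "Z \<le> 2 * \<kappa> * e + \<kappa>\<^sup>2 * M\<^sup>2 * Y / m" by (simp add: mult_ac)
  have "m * X \<le> Y"
    unfolding X_def Y_def integral_mult_right[symmetric]
    using int lower by (intro integral_le integrable_on_mult_right) (auto simp: a_def)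
  then have X: "X \<le> Y / m" using m(1) by (simp add: field_simps)
  have "integral {0..T} (\<lambda>s. (norm (\<iota> (wt s)))\<^sup>2)
      \<le> integral {0..T} (\<lambda>s. 2 * (norm (\<iota> (ut s)))\<^sup>2 + 2 * (norm (\<iota> (zt s)))\<^sup>2)"
  proof (rule integral_le[OF int(2)])
    show "(\<lambda>s. 2 * (norm (\<iota> (ut s)))\<^sup>2 + 2 * (norm (\<iota> (zt s)))\<^sup>2) integrable_on {0..T}"
      using int by (intro integrable_add integrable_on_mult_right)
    fix s
    have diff: "\<iota> (wt s) = \<iota> (ut s) - \<iota> (zt s)" by (simp add: zt_def \<iota>.diff)
    show "(norm (\<iota> (wt s)))\<^sup>2 \<le> 2 * (norm (\<iota> (ut s)))\<^sup>2 + 2 * (norm (\<iota> (zt s)))\<^sup>2"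
      unfolding diff using parallelogram[of "\<iota> (ut s)" "\<iota> (zt s)"]
        zero_le_power2[of "norm (\<iota> (ut s) + \<iota> (zt s))"] by linarith
  qed
  also have "\<dots> = 2 * X + 2 * Z"
    unfolding X_def Z_def using int by (simp add: integral_add integrable_on_mult_right)
  also have "\<dots> \<le> 2 * (Y / m) + 2 * (2 * \<kappa> * e + \<kappa>\<^sup>2 * M\<^sup>2 * Y / m)"
    by (intro add_mono mult_left_mono X Z') auto
  \<comment> \<open>With \<open>\<kappa> = 2 * C * T\<close>, the square of \<open>\<kappa>\<close>
    becomes the \<open>4 * C\<^sup>2 * T\<^sup>2\<close> of \<open>c_hat\<close>.\<close>
  also have "\<dots> = 2 / m * (1 + 4 * C\<^sup>2 * T\<^sup>2 * M\<^sup>2) * Y + 8 * C * T * e"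
    by (simp add: \<kappa>_def power2_eq_square add_divide_distrib algebra_simps)
  finally show ?thesis unfolding Y .
qed

lemma damped_interval_decay:
  fixes B :: "real \<Rightarrow> ('u::{real_inner, complete_space} \<Rightarrow>\<^sub>L 'h)"
    and \<iota> :: "'h \<Rightarrow> 'w::real_inner"
  assumes T: "0 < T" and B: "continuous_on {0..T} B"
    and u: "wave_on V S 0 T (\<lambda>t. - blinfun_apply (B t) (adjoint (blinfun_apply (B t)) (ut t))) u ut"
    and \<iota>: "bounded_linear \<iota>" "C > 0" "\<And>v. (norm (\<iota> v))\<^sup>2 \<le> C * (norm v)\<^sup>2"
    and m: "0 < m" "m \<le> M"
    and lower: "\<And>t v. t \<in> {0..T} \<Longrightarrow> m * (norm (\<iota> v))\<^sup>2 \<le> (norm (adjoint (blinfun_apply (B t)) v))\<^sup>2"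
    and upper: "\<And>t v. t \<in> {0..T} \<Longrightarrow> (norm (adjoint (blinfun_apply (B t)) v))\<^sup>2 \<le> M * (norm (\<iota> v))\<^sup>2"
    and c: "0 < c"
    and obs: "\<And>w0 w1 w wt. free_wave_solution V S w0 w1 w wt \<Longrightarrow>
        1/2 * ((normV S w0)\<^sup>2 + (norm w1)\<^sup>2) \<le> c * integral {0..T} (\<lambda>s. (norm (\<iota> (wt s)))\<^sup>2)"
  shows "std_energy S u ut T \<le> c_hat c C T m M * std_energy S u ut 0"
proof -
  define E0 where "E0 = std_energy S u ut 0"
  define ET where "ET = std_energy S u ut T"
  define K where "K = 2 * c * (1 + 4 * C\<^sup>2 * T\<^sup>2 * M\<^sup>2)"
  have K: "K > 0" unfolding K_def using c by (intro mult_pos_pos add_pos_nonneg) auto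
  obtain w0 w1 w wt where w: "\<And>n::nat. free_wave_solution V S (w0 n) (w1 n) (w n) (wt n)"
    and lim: "(\<lambda>n. S (w0 n)) \<longlonglongrightarrow> S (u 0)" "w1 \<longlonglongrightarrow> ut 0"
    using free_wave_data_dense by blast
  define e where "e = (\<lambda>n. std_energy S (\<lambda>t. u t - w n t) (\<lambda>t. ut t - wt n t) 0)"
  have ini: "w n 0 = w0 n" "wt n 0 = w1 n" "w0 n \<in> V" for n
    using w[of n] unfolding free_wave_solution_def weak_wave_solution_def by auto
  have uV: "u 0 \<in> V" using u T unfolding wave_on_def by simp
  have e_eq: "e = (\<lambda>n. 1/2 * ((norm (S (u 0) - S (w0 n)))\<^sup>2 + (norm (ut 0 - w1 n))\<^sup>2))"
    by (simp add: e_def std_energy_def normV_def ini S_diff uV)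
  have "e \<longlonglongrightarrow> 1/2 * ((norm (S (u 0) - S (u 0)))\<^sup>2 + (norm (ut 0 - ut 0))\<^sup>2)"
    unfolding e_eq by (intro tendsto_intros lim)
  then have e: "e \<longlonglongrightarrow> 0" by simp
  \<comment> \<open>The limit of the approximate inequalities; the summand with factor 0 is the
    limit of the error from the mismatch of the data.\<close>
  have "E0 \<le> c * (2 / m * (1 + 4 * C\<^sup>2 * T\<^sup>2 * M\<^sup>2) * (E0 - ET) + 8 * C * T * 0)"
  proof (rule LIMSEQ_le)
    show "(\<lambda>n. 1/2 * ((norm (S (w0 n)))\<^sup>2 + (norm (w1 n))\<^sup>2)) \<longlonglongrightarrow> E0"
      unfolding E0_def std_energy_def normV_def by (intro tendsto_intros lim)
    show "(\<lambda>n. c * (2 / m * (1 + 4 * C\<^sup>2 * T\<^sup>2 * M\<^sup>2) * (E0 - ET) + 8 * C * T * e n))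
        \<longlonglongrightarrow> c * (2 / m * (1 + 4 * C\<^sup>2 * T\<^sup>2 * M\<^sup>2) * (E0 - ET) + 8 * C * T * 0)"
      by (intro tendsto_intros e)
    have "1/2 * ((norm (S (w0 n)))\<^sup>2 + (norm (w1 n))\<^sup>2)
        \<le> c * (2 / m * (1 + 4 * C\<^sup>2 * T\<^sup>2 * M\<^sup>2) * (E0 - ET) + 8 * C * T * e n)" for n
    proof -
      have "wave_on V S 0 T (\<lambda>t. 0) (w n) (wt n)"
        using weak_wave_solution_imp_wave_on[OF w[unfolded free_wave_solution_def]] by simp
      note damped_wave_observability_approx[OF T B u this \<iota> m lower upper]
      then have "integral {0..T} (\<lambda>s. (norm (\<iota> (wt n s)))\<^sup>2)
          \<le> 2 / m * (1 + 4 * C\<^sup>2 * T\<^sup>2 * M\<^sup>2) * (E0 - ET) + 8 * C * T * e n"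
        by (simp add: E0_def ET_def e_def)
      then show ?thesis
        using obs[OF w[of n]] c unfolding normV_def by (meson mult_left_mono less_imp_le order_trans)
    qed
    then show "\<exists>N. \<forall>n\<ge>N. 1/2 * ((norm (S (w0 n)))\<^sup>2 + (norm (w1 n))\<^sup>2)
        \<le> c * (2 / m * (1 + 4 * C\<^sup>2 * T\<^sup>2 * M\<^sup>2) * (E0 - ET) + 8 * C * T * e n)" by blast
  qed
  also have "\<dots> = K * (E0 - ET) / m" by (simp add: K_def)
  finally have "m * E0 \<le> K * (E0 - ET)" using m(1) by (simp add: field_simps)
  \<comment> \<open>Lowering \<open>m * E0\<close> to \<open>m * ET\<close> on the left gathers both
    multiples of \<open>ET\<close>, which gives the ratio \<open>K / (m + K)\<close> below
    1.\<close>
  moreover have "ET \<le> E0"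
    unfolding ET_def E0_def using damped_energy(2)[OF B u] T by simp
  then have "m * ET \<le> m * E0" using m(1) by simp
  ultimately have "(m + K) * ET \<le> K * E0" by (simp add: algebra_simps)
  then have "ET \<le> K / (m + K) * E0" using m(1) K by (simp add: field_simps)
  then show ?thesis by (simp add: c_hat_def K_def E0_def ET_def)
qed

end

section \<open>Gronwall's lemma, exponential decay from geometric decay, and bounds at right
  endpoints\<close>

lemma gronwall_integral:
  fixes h \<phi> :: "real \<Rightarrow> real"
  assumes h: "continuous_on {a..b} h"
    and \<phi>: "\<And>t. t \<in> {a..b} \<Longrightarrow> \<phi> t = \<phi> a + integral {a..t} h"
    and le: "\<And>t. t \<in> {a..b} \<Longrightarrow> h t \<le> L * \<phi> t"
    and t: "t \<in> {a..b}"
  shows "\<phi> t \<le> \<phi> a * exp (L * (t - a))"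
proof -
  \<comment> \<open>\<open>\<Phi>\<close> agrees with \<open>\<phi>\<close> on the interval and is
    differentiable there by the fundamental theorem; \<open>\<psi>\<close> adds the integrating
    factor and is decreasing.\<close>
  define \<Phi> where "\<Phi> = (\<lambda>s. \<phi> a + integral {a..s} h)"
  define \<psi> where "\<psi> = (\<lambda>s. \<Phi> s * exp (- L * (s - a)))"
  have d\<psi>: "(\<psi> has_real_derivative (h s - L * \<Phi> s) * exp (- L * (s - a))) (at s within {a..b})"
    if s: "s \<in> {a..b}" for s
  proof -
    have "(\<Phi> has_real_derivative h s) (at s within {a..b})"
      unfolding \<Phi>_def using DERIV_add[OF DERIV_const integral_has_real_derivative[OF h s]] by simp
    then show ?thesis unfolding \<psi>_def
      by (auto intro!: derivative_eq_intros simp: algebra_simps)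
  qed
  have "\<psi> t \<le> \<psi> a"
  proof (rule DERIV_nonpos_imp_decreasing_open[where f = \<psi>])
    have "continuous_on {a..b} \<psi>"
      using d\<psi> DERIV_continuous continuous_on_eq_continuous_within by blast
    then show "continuous_on {a..t} \<psi>" using t by (auto intro: continuous_on_subset)
    fix s assume s: "a < s" "s < t"
    then have "s \<in> {a..b}" "at s within {a..b} = at s"
      using t by (auto intro: at_within_interior)
    moreover have "(h s - L * \<Phi> s) * exp (- L * (s - a)) \<le> 0"
      using le[of s] \<phi>[of s] s t by (intro mult_nonpos_nonneg) (auto simp: \<Phi>_def)
    ultimately show "\<exists>y. (\<psi> has_real_derivative y) (at s) \<and> y \<le> 0"
      using d\<psi>[of s] by auto
  qed (use t in simp)
  then have "\<phi> t * exp (- L * (t - a)) \<le> \<phi> a"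
    using \<phi>[OF t] by (simp add: \<psi>_def \<Phi>_def)
  then have "\<phi> t * exp (- L * (t - a)) * exp (L * (t - a)) \<le> \<phi> a * exp (L * (t - a))"
    by (rule mult_right_mono) simp
  then show ?thesis by (simp add: mult.assoc flip: exp_add)
qed

text \<open>The bound is \<open>\<delta>\<close> to the power \<open>t / P - 1\<close>: the factor
  \<open>1 / \<delta>\<close> pays for rounding \<open>t / P\<close> down to a whole number of
  cycles.\<close>

lemma geometric_imp_exponential_decay:
  fixes E :: "real \<Rightarrow> real"
  assumes P: "0 < P" and \<delta>: "0 < \<delta>" "\<delta> < 1" and E0: "0 \<le> E 0"
    and step: "\<And>n::nat. E (real (Suc n) * P) \<le> \<delta> * E (real n * P)"
    and mono: "\<And>n t. real n * P \<le> t \<Longrightarrow> t \<le> real (Suc n) * P \<Longrightarrow> E t \<le> E (real n * P)"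
    and t: "0 \<le> t"
  shows "E t \<le> 1 / \<delta> * exp (ln \<delta> / P * t) * E 0"
proof -
  have pow: "E (real n * P) \<le> \<delta> ^ n * E 0" for n
  proof (induction n)
    case (Suc n)
    have "E (real (Suc n) * P) \<le> \<delta> * E (real n * P)" by (rule step)
    also have "\<dots> \<le> \<delta> * (\<delta> ^ n * E 0)" using Suc \<delta>(1) by (intro mult_left_mono) auto
    finally show ?case by simp
  qed simp
  define n where "n = nat \<lfloor>t / P\<rfloor>"
  have "real n = of_int \<lfloor>t / P\<rfloor>" unfolding n_def using P t by simp
  then have "real n \<le> t / P" "t / P < real (Suc n)" by linarith+
  then have n: "real n * P \<le> t" "t \<le> real (Suc n) * P" using P by (auto simp: field_simps)
  have "ln \<delta> * real (Suc n) \<le> ln \<delta> * (t / P)"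
    using \<delta> \<open>t / P < real (Suc n)\<close> by (intro mult_left_mono_neg) auto
  then have "exp (ln \<delta> * real (Suc n)) \<le> exp (ln \<delta> / P * t)" by (simp add: field_simps)
  moreover have "exp (ln \<delta> * real (Suc n)) = \<delta> ^ Suc n"
    using \<delta>(1) exp_of_nat2_mult[of "ln \<delta>" "Suc n"] by simp
  ultimately have "\<delta> ^ Suc n \<le> exp (ln \<delta> / P * t)" by (simp only:)
  then have "\<delta> ^ n \<le> 1 / \<delta> * exp (ln \<delta> / P * t)" using \<delta>(1) by (simp add: pos_le_divide_eq mult.commute)
  then have "\<delta> ^ n * E 0 \<le> 1 / \<delta> * exp (ln \<delta> / P * t) * E 0"
    using E0 by (rule mult_right_mono)
  then show ?thesis using mono[OF n] pow[of n] by linarith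
qed

text \<open>The bounds on the adjoints are assumed on half-open intervals, while the continuous
  extensions of \<open>B1\<close> and \<open>B2\<close> are used on closed ones; this carries the
  bounds to the endpoint.\<close>

lemma le_on_right_end:
  fixes f g :: "real \<Rightarrow> real"
  assumes fg: "continuous_on {a..b} f" "continuous_on {a..b} g" and ab: "a < b"
    and le: "\<And>t. t \<in> {a..<b} \<Longrightarrow> f t \<le> g t" and t: "t \<in> {a..b}"
  shows "f t \<le> g t"
proof -
  have "(\<lambda>t. f t - g t) t \<le> 0"
    by (rule continuous_le_on_closure[where S = "{a..<b}"])
      (use ab le t in \<open>auto intro!: continuous_on_diff fg\<close>)
  then show ?thesis by simp
qed

lemma C1_up_to_right_end_imp_C0:
  assumes "C1_up_to_right_end B a b"
  shows "C0_up_to_right_end B a b"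
proof -
  obtain F F' where F: "\<forall>t\<in>{a..<b}. F t = B t"
    and F': "\<And>t. t \<in> {a..b} \<Longrightarrow> (F has_vector_derivative F' t) (at t within {a..b})"
    using assms unfolding C1_up_to_right_end_def by blast
  have "continuous_on {a..b} F"
    unfolding continuous_on_eq_continuous_within using has_vector_derivative_continuous[OF F'] by blast
  with F show ?thesis unfolding C0_up_to_right_end_def by blast
qed

section \<open>Odd intervals and the full cycle\<close>

context sqrt_inverse
begin

text \<open>\<open>v\<close> stands for the delayed velocity and \<open>E0\<close> bounds its
  kinetic energy. The power of the delayed term is controlled by \<open>norm (v t)\<close> and
  \<open>norm (ut t)\<close> together, so it is the energy plus the constant \<open>E0\<close> that
  satisfies a closed Gronwall inequality.\<close>

lemma delayed_interval_growth:
  fixes B :: "real \<Rightarrow> ('u::{real_inner, complete_space} \<Rightarrow>\<^sub>L 'h)"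
    and \<iota> :: "'h \<Rightarrow> 'w::real_normed_vector"
  assumes B: "continuous_on {a..b} B" and v: "continuous_on {a..b} v"
    and u: "wave_on V S a b (\<lambda>t. - blinfun_apply (B t) (adjoint (blinfun_apply (B t)) (v t))) u ut"
    and \<iota>: "\<And>x. (norm (\<iota> x))\<^sup>2 \<le> C * (norm x)\<^sup>2" and M: "0 < M"
    and upper: "\<And>t x. t \<in> {a..b} \<Longrightarrow> (norm (adjoint (blinfun_apply (B t)) x))\<^sup>2 \<le> M * (norm (\<iota> x))\<^sup>2"
    and C: "0 < C" and v_le: "\<And>t. t \<in> {a..b} \<Longrightarrow> (norm (v t))\<^sup>2 \<le> 2 * E0"
    and t: "t \<in> {a..b}"
  shows "std_energy S u ut t + E0 \<le> (std_energy S u ut a + E0) * exp (C * M * (t - a))"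
proof -
  define f where "f = (\<lambda>t. - blinfun_apply (B t) (adjoint (blinfun_apply (B t)) (v t)))"
  have ut: "continuous_on {a..b} ut" using u unfolding wave_on_def by blast
  have f: "continuous_on {a..b} f"
    unfolding f_def by (intro continuous_on_minus blinfun.continuous_on B continuous_on_adjoint_blinfun v)
  note u' = u[folded f_def]
  show ?thesis
  proof (rule gronwall_integral[where h = "\<lambda>t. f t \<bullet> ut t" and b = b])
    show "continuous_on {a..b} (\<lambda>t. f t \<bullet> ut t)" by (intro continuous_intros f ut)
    show "std_energy S u ut s + E0 = std_energy S u ut a + E0 + integral {a..s} (\<lambda>t. f t \<bullet> ut t)"
      if "s \<in> {a..b}" for s
      using energy_identity_on_subinterval[OF u' f that] by simp
    fix s assume s: "s \<in> {a..b}"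
    define p where "p = adjoint (blinfun_apply (B s)) (v s)"
    define q where "q = adjoint (blinfun_apply (B s)) (ut s)"
    have adj_le: "(norm (adjoint (blinfun_apply (B s)) x))\<^sup>2 \<le> C * M * (norm x)\<^sup>2" for x
      using order_trans[OF upper[OF s] mult_left_mono[OF \<iota>]] M by (simp add: mult_ac)
    have "f s \<bullet> ut s = - (p \<bullet> q)" by (simp add: f_def p_def q_def adjoint_blinfun)
    also have "\<dots> \<le> ((norm p)\<^sup>2 + (norm q)\<^sup>2) / 2"
      using inner_ge_zero[of "p + q"] by (simp add: power2_norm_eq_inner inner_add inner_commute)
    also have "\<dots> \<le> (C * M * (norm (v s))\<^sup>2 + C * M * (norm (ut s))\<^sup>2) / 2"
      unfolding p_def q_def by (intro divide_right_mono add_mono adj_le) auto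
    also have "\<dots> = C * M * (((norm (v s))\<^sup>2 + (norm (ut s))\<^sup>2) / 2)" by (simp add: algebra_simps)
    also have "\<dots> \<le> C * M * (std_energy S u ut s + E0)"
    proof (intro mult_left_mono)
      have "(norm (ut s))\<^sup>2 \<le> 2 * std_energy S u ut s" by (simp add: std_energy_def)
      then show "((norm (v s))\<^sup>2 + (norm (ut s))\<^sup>2) / 2 \<le> std_energy S u ut s + E0"
        using v_le[OF s] by argo
    qed (use C M in simp)
    finally show "f s \<bullet> ut s \<le> C * M * (std_energy S u ut s + E0)" .
  qed (rule t)
qed

lemma cycle_decay:
  fixes B1 :: "real \<Rightarrow> ('u1::{real_inner, complete_space} \<Rightarrow>\<^sub>L 'h)"
    and B2 :: "real \<Rightarrow> ('u2::{real_inner, complete_space} \<Rightarrow>\<^sub>L 'h)"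
    and \<iota>1 :: "'h \<Rightarrow> 'w1::real_inner" and \<iota>2 :: "'h \<Rightarrow> 'w2::real_normed_vector"
  assumes order: "0 \<le> a" "a < b" "b < d" and delay: "\<tau> \<le> b - a" "d - b \<le> \<tau>"
    and tn: "{a<..<b} \<inter> range tn = {}" "{b<..<d} \<inter> range tn = {}"
    and u: "delayed_wave_solution V S tn \<tau> B1 B2 u0 u1 u ut"
    and B2_zero: "\<And>t. t \<in> {a..<b} \<Longrightarrow> B2 t = 0" and B1_zero: "\<And>t. t \<in> {b..<d} \<Longrightarrow> B1 t = 0"
    and B1: "C0_up_to_right_end B1 a b" and B2: "C0_up_to_right_end B2 b d"
    and \<iota>1: "bounded_linear \<iota>1" "C1 > 0" "\<And>v. (norm (\<iota>1 v))\<^sup>2 \<le> C1 * (norm v)\<^sup>2"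
    and \<iota>2: "C2 > 0" "\<And>v. (norm (\<iota>2 v))\<^sup>2 \<le> C2 * (norm v)\<^sup>2"
    and m: "0 < m" "m \<le> M" and M': "0 < M'"
    and lower: "\<And>t v. t \<in> {a..<b} \<Longrightarrow> m * (norm (\<iota>1 v))\<^sup>2 \<le> (norm (adjoint (blinfun_apply (B1 t)) v))\<^sup>2"
    and upper: "\<And>t v. t \<in> {a..<b} \<Longrightarrow> (norm (adjoint (blinfun_apply (B1 t)) v))\<^sup>2 \<le> M * (norm (\<iota>1 v))\<^sup>2"
    and upper': "\<And>t v. t \<in> {b..<d} \<Longrightarrow> (norm (adjoint (blinfun_apply (B2 t)) v))\<^sup>2 \<le> M' * (norm (\<iota>2 v))\<^sup>2"
    and c: "0 < c"
    and obs: "\<And>w0 w1 w wt. free_wave_solution V S w0 w1 w wt \<Longrightarrow>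
        1/2 * ((normV S w0)\<^sup>2 + (norm w1)\<^sup>2) \<le> c * integral {0..b - a} (\<lambda>s. (norm (\<iota>1 (wt s)))\<^sup>2)"
  shows "t \<in> {a..b} \<Longrightarrow> std_energy S u ut t \<le> std_energy S u ut a"
    and "t \<in> {b..d} \<Longrightarrow> std_energy S u ut t
      \<le> (exp (C2 * M' * (d - b)) * (c_hat c C1 (b - a) m M + 1) - 1) * std_energy S u ut a"
proof -
  define E where "E = std_energy S u ut"
  obtain F where F: "\<And>t. t \<in> {a..<b} \<Longrightarrow> F t = B1 t" "continuous_on {a..b} F"
    using B1 unfolding C0_up_to_right_end_def by blast
  obtain G where G: "\<And>t. t \<in> {b..<d} \<Longrightarrow> G t = B2 t" "continuous_on {b..d} G"
    using B2 unfolding C0_up_to_right_end_def by blast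
  have norm_adj: "continuous_on I (\<lambda>t. (norm (adjoint (blinfun_apply (H t)) v))\<^sup>2)"
    if "continuous_on I H" for I v and H :: "real \<Rightarrow> ('x::{real_inner, complete_space} \<Rightarrow>\<^sub>L 'h)"
    by (intro continuous_on_power continuous_on_norm continuous_on_adjoint_blinfun that continuous_on_const)
  have F_lower: "m * (norm (\<iota>1 v))\<^sup>2 \<le> (norm (adjoint (blinfun_apply (F t)) v))\<^sup>2" if "t \<in> {a..b}" for t v
    by (rule le_on_right_end[OF continuous_on_const norm_adj[OF F(2)] order(2) _ that])
      (simp only: F(1) lower)
  have F_upper: "(norm (adjoint (blinfun_apply (F t)) v))\<^sup>2 \<le> M * (norm (\<iota>1 v))\<^sup>2" if "t \<in> {a..b}" for t v
    by (rule le_on_right_end[OF norm_adj[OF F(2)] continuous_on_const order(2) _ that])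
      (simp only: F(1) upper)
  have G_upper: "(norm (adjoint (blinfun_apply (G t)) v))\<^sup>2 \<le> M' * (norm (\<iota>2 v))\<^sup>2" if "t \<in> {b..d}" for t v
    by (rule le_on_right_end[OF norm_adj[OF G(2)] continuous_on_const order(3) _ that])
      (simp only: G(1) upper')
  note us = u[unfolded delayed_wave_solution_def]
  have ut: "continuous_on {0..} ut" using us unfolding weak_wave_solution_def by blast
  have w1: "wave_on V S a b (\<lambda>t. - blinfun_apply (F t) (adjoint (blinfun_apply (F t)) (ut t))) u ut"
    by (rule wave_on_cong[OF weak_wave_solution_imp_wave_on[OF us order(1) tn(1)]])
      (use F(1) B2_zero in auto)
  have w2: "wave_on V S b d (\<lambda>t. - blinfun_apply (G t) (adjoint (blinfun_apply (G t)) (ut (t - \<tau>)))) u ut"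
    by (rule wave_on_cong[OF weak_wave_solution_imp_wave_on[OF us _ tn(2)]])
      (use G(1) B1_zero order in auto)
  have mono: "E t \<le> E a" if "t \<in> {a..b}" for t
    unfolding E_def using damped_energy(2)[OF F(2) w1 that] .
  then show "t \<in> {a..b} \<Longrightarrow> std_energy S u ut t \<le> std_energy S u ut a"
    unfolding E_def .
  have Eb: "E b \<le> c_hat c C1 (b - a) m M * E a"
  proof -
    \<comment> \<open>Observability is formulated on an interval starting at 0, so the solution and
      the damping are shifted by \<open>a\<close>.\<close>
    have F': "continuous_on {0..b - a} (\<lambda>t. F (a + t))"
      by (rule continuous_on_compose2[OF F(2)]) (auto intro!: continuous_intros)
    have "0 < b - a" using order by simp
    note damped_interval_decay[OF this F' wave_on_shift[OF w1] \<iota>1 m _ _ c obs]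
    then have "std_energy S (\<lambda>t. u (a + t)) (\<lambda>t. ut (a + t)) (b - a)
        \<le> c_hat c C1 (b - a) m M * std_energy S (\<lambda>t. u (a + t)) (\<lambda>t. ut (a + t)) 0"
      using F_lower F_upper by simp
    then show ?thesis by (simp add: E_def std_energy_def)
  qed
  show "std_energy S u ut t
      \<le> (exp (C2 * M' * (d - b)) * (c_hat c C1 (b - a) m M + 1) - 1) * std_energy S u ut a"
    if t: "t \<in> {b..d}"
  proof -
    have v: "continuous_on {b..d} (\<lambda>t. ut (t - \<tau>))"
      by (rule continuous_on_compose2[OF ut]) (use order delay in \<open>auto intro!: continuous_intros\<close>)
    \<comment> \<open>From \<open>\<tau> \<le> b - a\<close> and \<open>d - b \<le> \<tau>\<close>
      the time \<open>s - \<tau>\<close> lies in {a..b}, where the energy is at most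
      \<open>E a\<close>.\<close>
    have v_le: "(norm (ut (s - \<tau>)))\<^sup>2 \<le> 2 * E a" if "s \<in> {b..d}" for s
    proof -
      have "(norm (ut (s - \<tau>)))\<^sup>2 \<le> 2 * E (s - \<tau>)" by (simp add: E_def std_energy_def)
      also have "\<dots> \<le> 2 * E a" using mono[of "s - \<tau>"] that delay by simp
      finally show ?thesis .
    qed
    have "0 \<le> E b" by (simp add: E_def std_energy_def)
    have "0 \<le> E a" by (simp add: E_def std_energy_def)
    have "E t + E a \<le> (E b + E a) * exp (C2 * M' * (t - b))"
      unfolding E_def
      using delayed_interval_growth[OF G(2) v w2 \<iota>2(2) M' G_upper \<iota>2(1) v_le t] by (simp add: E_def)
    also have "\<dots> \<le> (E b + E a) * exp (C2 * M' * (d - b))"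
      using t \<iota>2(1) M' \<open>0 \<le> E b\<close> \<open>0 \<le> E a\<close> by (intro mult_left_mono) auto
    also have "\<dots> \<le> (c_hat c C1 (b - a) m M * E a + E a) * exp (C2 * M' * (d - b))"
      using Eb by (intro mult_right_mono) auto
    finally show ?thesis by (simp add: E_def algebra_simps)
  qed
qed

end

text \<open>The supremum is formed in \<open>ereal\<close>, where it always exists; its equality
  with \<open>ereal dhat\<close> therefore also expresses that the factors are bounded
  above.\<close>

theorem theorem3p10:
  fixes D :: "'h::{real_inner, complete_space} set" and A :: "'h \<Rightarrow> 'h"
    and V :: "'h set" and S :: "'h \<Rightarrow> 'h"
    and \<tau> :: real and tn :: "nat \<Rightarrow> real"
    and B1 :: "real \<Rightarrow> ('u1::{real_inner, complete_space} \<Rightarrow>\<^sub>L 'h)"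
    and B2 :: "real \<Rightarrow> ('u2::{real_inner, complete_space} \<Rightarrow>\<^sub>L 'h)"
    and \<iota>1 :: "'h \<Rightarrow> 'w1::{real_inner, complete_space}"
    and \<iota>2 :: "'h \<Rightarrow> 'w2::{real_inner, complete_space}"
    and C1 C2 :: real and m M :: "nat \<Rightarrow> real"
    and Tbar :: real and c :: "real \<Rightarrow> real"
    and Tstar Ttilde dhat :: real
  assumes A: "self_adjoint_op D A" "positive_op D A" "compact_inverse D A"
    and S: "is_sqrt_op D A V S"
    and \<tau>: "\<tau> > 0"
    and tn: "tn 0 = 0" "strict_mono tn"
    and tn_even_ge: "\<And>n. tn (2*n+1) - tn (2*n) \<ge> \<tau>"
    and B2_zero: "\<And>n t. t \<in> {tn (2*n)..<tn (2*n+1)} \<Longrightarrow> B2 t = 0"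
    and B1_zero: "\<And>n t. t \<in> {tn (2*n+1)..<tn (2*n+2)} \<Longrightarrow> B1 t = 0"
    and B1_C1: "\<And>n. C1_up_to_right_end B1 (tn (2*n)) (tn (2*n+1))"
    and B2_C0: "\<And>n. C0_up_to_right_end B2 (tn (2*n+1)) (tn (2*n+2))"
    and W1: "bounded_linear \<iota>1" "inj \<iota>1" "C1 > 0" "\<And>v. (norm (\<iota>1 v))\<^sup>2 \<le> C1 * (norm v)\<^sup>2"
    and W2: "bounded_linear \<iota>2" "inj \<iota>2" "C2 > 0" "\<And>v. (norm (\<iota>2 v))\<^sup>2 \<le> C2 * (norm v)\<^sup>2"
    and mM_even: "\<And>n. 0 < m (2*n)" "\<And>n. m (2*n) \<le> M (2*n)"
    and M_odd: "\<And>n. 0 < M (2*n+1)"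
    and i_lower: "\<And>n t v. t \<in> {tn (2*n)..<tn (2*n+1)} \<Longrightarrow>
        m (2*n) * (norm (\<iota>1 v))\<^sup>2 \<le> (norm (adjoint (blinfun_apply (B1 t)) v))\<^sup>2"
    and i_upper: "\<And>n t v. t \<in> {tn (2*n)..<tn (2*n+1)} \<Longrightarrow>
        (norm (adjoint (blinfun_apply (B1 t)) v))\<^sup>2 \<le> M (2*n) * (norm (\<iota>1 v))\<^sup>2"
    and ii: "\<And>n t v. t \<in> {tn (2*n+1)..<tn (2*n+2)} \<Longrightarrow>
        (norm (adjoint (blinfun_apply (B2 t)) v))\<^sup>2 \<le> M (2*n+1) * (norm (\<iota>2 v))\<^sup>2"
    and Tbar: "Tbar > 0"
    and observability_const: "\<And>T. T > Tbar \<Longrightarrow> c T > 0"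
    and observability: "\<And>T w0 w1 w wt. T > Tbar \<Longrightarrow> free_wave_solution V S w0 w1 w wt \<Longrightarrow>
        1/2 * ((normV S w0)\<^sup>2 + (norm w1)\<^sup>2) \<le> c T * integral {0..T} (\<lambda>s. (norm (\<iota>1 (wt s)))\<^sup>2)"
    and T_even: "\<And>n. tn (2*n+1) - tn (2*n) = Tstar"
    and Tstar: "Tstar > Tbar" "Tstar \<ge> \<tau>"
    and T_odd: "\<And>n. tn (2*n+2) - tn (2*n+1) = Ttilde"
    and Ttilde: "Ttilde \<le> \<tau>"
    and dhat: "(SUP n. ereal (exp (C2 * M (2*n+1) * Ttilde)
          * (c_hat (c Tstar) C1 (tn (2*n+1) - tn (2*n)) (m (2*n)) (M (2*n)) + 1) - 1)) = ereal dhat"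
      "dhat < 1"
  shows "\<exists>\<gamma>>0. \<exists>\<mu>>0. \<forall>u0\<in>V. \<forall>u1 u ut. delayed_wave_solution V S tn \<tau> B1 B2 u0 u1 u ut \<longrightarrow>
    (\<forall>t>0. std_energy S u ut t \<le> \<gamma> * exp (- \<mu> * t) * std_energy S u ut 0)"
proof -
  obtain Q where "sqrt_inverse V S Q" using sqrt_inverse_exists[OF A S] by blast
  then interpret sqrt_inverse V S Q .
  define P where "P = Tstar + Ttilde"
  have less: "tn (2*n) < tn (2*n+1)" "tn (2*n+1) < tn (2*n+2)" for n
    using tn(2) by (simp_all add: strict_mono_less)
  have P: "0 < P" using less[of 0] T_even[of 0] T_odd[of 0] by (simp add: P_def)
  have tn_even: "tn (2*n) = real n * P" for n
  proof (induction n)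
    case (Suc n)
    have "tn (2 * Suc n) = tn (2*n) + P" using T_even[of n] T_odd[of n] by (simp add: P_def)
    then show ?case using Suc by (simp add: algebra_simps)
  qed (simp add: tn)
  have gap: "{tn k<..<tn (Suc k)} \<inter> range tn = {}" for k
  proof -
    have "\<not> (tn k < tn j \<and> tn j < tn (Suc k))" for j
      using strict_mono_less[OF tn(2)] by auto
    then show ?thesis by auto
  qed
  define \<delta> where "\<delta> = (\<lambda>n. exp (C2 * M (2*n+1) * Ttilde)
      * (c_hat (c Tstar) C1 (tn (2*n+1) - tn (2*n)) (m (2*n)) (M (2*n)) + 1) - 1)"
  have \<delta>_le: "\<delta> n \<le> dhat" for n
  proof -
    have "ereal (\<delta> n) \<le> (SUP n. ereal (\<delta> n))" by (rule SUP_upper) simp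
    then show ?thesis unfolding \<delta>_def dhat(1) by simp
  qed
  have c: "0 < c Tstar" using observability_const Tstar(1) by blast
  \<comment> \<open>Positivity makes \<open>ln dhat\<close> and \<open>1 / dhat\<close> meaningful.
    It already follows from the cycle 0, since \<open>c_hat\<close> is positive and the exponential
    is at least 1.\<close>
  have dhat_pos: "0 < dhat"
  proof -
    have Ttilde_pos: "0 < Ttilde" using less[of 0] T_odd[of 0] by simp
    have "0 < 2 * c Tstar * (1 + 4 * C1\<^sup>2 * (tn 1 - tn 0)\<^sup>2 * (M 0)\<^sup>2)"
      using c by (intro mult_pos_pos add_pos_nonneg) auto
    then have "0 < c_hat (c Tstar) C1 (tn 1 - tn 0) (m 0) (M 0)"
      unfolding c_hat_def using mM_even(1)[of 0] by (intro divide_pos_pos add_pos_pos) auto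
    moreover have "1 \<le> exp (C2 * M 1 * Ttilde)"
      using W2(3) M_odd[of 0] Ttilde_pos by simp
    ultimately have "1 * 1 < exp (C2 * M 1 * Ttilde) * (c_hat (c Tstar) C1 (tn 1 - tn 0) (m 0) (M 0) + 1)"
      by (intro mult_le_less_imp_less) auto
    then show ?thesis using \<delta>_le[of 0] by (simp add: \<delta>_def)
  qed
  \<comment> \<open>The witnesses are \<open>1 / dhat\<close> and \<open>- ln dhat / P\<close>; they
    involve only the contraction factor and the cycle length, and so serve all solutions.\<close>
  have "std_energy S u ut t \<le> 1 / dhat * exp (- (- ln dhat / P) * t) * std_energy S u ut 0"
    if u: "delayed_wave_solution V S tn \<tau> B1 B2 u0 u1 u ut" and t: "0 < t" for u0 u1 u ut t
  proof -
    have E_nonneg: "0 \<le> std_energy S u ut s" for s by (simp add: std_energy_def)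
    have cycle: "s \<in> {tn (2*n)..tn (2*n+1)} \<Longrightarrow> std_energy S u ut s \<le> std_energy S u ut (tn (2*n))"
      "s \<in> {tn (2*n+1)..tn (2*n+2)} \<Longrightarrow> std_energy S u ut s \<le> dhat * std_energy S u ut (tn (2*n))" for n s
    proof -
      have start: "0 \<le> tn (2*n)" using P by (simp add: tn_even)
      have delay: "tn (2*n+2) - tn (2*n+1) \<le> \<tau>" using T_odd Ttilde by simp
      have obs: "1/2 * ((normV S w0)\<^sup>2 + (norm w1)\<^sup>2)
          \<le> c Tstar * integral {0..tn (2*n+1) - tn (2*n)} (\<lambda>s. (norm (\<iota>1 (wt s)))\<^sup>2)"
        if "free_wave_solution V S w0 w1 w wt" for w0 w1 w wt
        unfolding T_even by (rule observability[OF Tstar(1) that])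
      have gaps: "{tn (2*n)<..<tn (2*n+1)} \<inter> range tn = {}" "{tn (2*n+1)<..<tn (2*n+2)} \<inter> range tn = {}"
        using gap[of "2*n"] gap[of "2*n+1"] by simp_all
      note decay = cycle_decay[OF start less tn_even_ge delay gaps u B2_zero[of _ n] B1_zero[of _ n]
          C1_up_to_right_end_imp_C0[OF B1_C1] B2_C0 W1(1,3,4) W2(3,4) mM_even M_odd
          i_lower[of _ n] i_upper[of _ n] ii[of _ n] c obs]
      show "std_energy S u ut s \<le> std_energy S u ut (tn (2*n))" if "s \<in> {tn (2*n)..tn (2*n+1)}"
        using that by (rule decay(1)[rotated -1])
      assume s: "s \<in> {tn (2*n+1)..tn (2*n+2)}"
      have "std_energy S u ut s \<le> \<delta> n * std_energy S u ut (tn (2*n))"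
        unfolding \<delta>_def T_odd[of n, symmetric] by (rule decay(2)[OF _ _ _ _ _ _ s])
      also have "\<dots> \<le> dhat * std_energy S u ut (tn (2*n))"
        by (intro mult_right_mono \<delta>_le E_nonneg)
      finally show "std_energy S u ut s \<le> dhat * std_energy S u ut (tn (2*n))" .
    qed
    have "std_energy S u ut t \<le> 1 / dhat * exp (ln dhat / P * t) * std_energy S u ut 0"
    proof (rule geometric_imp_exponential_decay[OF P dhat_pos dhat(2) E_nonneg])
      fix n :: nat
      have next_even: "tn (2*n+2) = real (Suc n) * P" using tn_even[of "Suc n"] by simp
      show "std_energy S u ut (real (Suc n) * P) \<le> dhat * std_energy S u ut (real n * P)"
        unfolding next_even[symmetric] tn_even[symmetric]
        using cycle(2)[of "tn (2*n+2)" n] less(2)[of n] by auto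
      fix s assume s: "real n * P \<le> s" "s \<le> real (Suc n) * P"
      \<comment> \<open>As \<open>dhat < 1\<close>, the bound on the odd half is also at most the
        energy at the start of the cycle, which thus dominates the whole cycle.\<close>
      have "dhat * std_energy S u ut (tn (2*n)) \<le> std_energy S u ut (tn (2*n))"
        using dhat(2) E_nonneg mult_right_mono[of dhat 1] by simp
      then show "std_energy S u ut s \<le> std_energy S u ut (real n * P)"
        using cycle[where s = s and n = n] s unfolding next_even tn_even
        by (cases "s \<le> tn (2*n+1)") auto
    qed (use t in simp)
    then show ?thesis by simp
  qed
  moreover have "0 < 1 / dhat" "0 < - ln dhat / P" using dhat_pos dhat(2) P by (auto intro: divide_neg_pos)
  ultimately show ?thesis by blast
qed

end
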